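(* Let $F$ be a field and let $G$ be a finite group which is not cyclic. Then there exist S-rings $S_1, S_2 \subseteq FG$ over $G$ which are distinct ($S_1 \neq S_2$) and Cayley-isomorphic.
   Context: For $C \subseteq G$ write $\overline{C} = \sum_{g\in C} g \in FG$ and $C^{(-1)} = \{g^{-1} : g \in C\}$. An S-ring (Schur ring) over $G$ is a subalgebra $S$ of the group algebra $FG$ for which there are disjoint nonempty subsets $T_1,\dots,T_n$ of $G$ (the basic sets) such that $\overline{T_1},\dots,\overline{T_n}$ form a basis of $S$, (i) for every $i$ there is $j$ with $T_i^{(-1)} = T_j$, and (ii) $T_1 = \{1\}$ and $G = T_1\cup\cdots\cup T_n$. Every group automorphism $\phi \in \operatorname{Aut}(G)$, extended linearly to $FG$, restricts to an isomorphism from an S-ring $S$ over $G$ onto the (possibly distinct) S-ring $\phi(S)$ over $G$; such an isomorphism is called a Cayley isomorphism. Two S-rings $S_1,S_2$ over $G$ are Cayley-isomorphic if $\phi(S_1)=S_2$ for some $\phi\in\operatorname{Aut}(G)$. *)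

theory Defs
  imports "HOL-Algebra.Algebra" "HOL-Library.Disjoint_Sets"
begin

text \<open>
  The group algebra of a finite group \<open>G\<close> over a field \<open>F\<close>: its elements are the coefficient
  functions \<open>carrier G \<rightarrow> carrier F\<close>, normalised to be \<open>undefined\<close> outside \<open>carrier G\<close>, and its
  product is the convolution.
\<close>

definition group_algebra ::
    "('f, 'm) ring_scheme \<Rightarrow> ('g, 'n) monoid_scheme \<Rightarrow> ('f, 'g \<Rightarrow> 'f) module" where
  "group_algebra F G =
    \<lparr>carrier = carrier G \<rightarrow>\<^sub>E carrier F,
     monoid.mult = (\<lambda>a b. \<lambda>x\<in>carrier G.
       \<Oplus>\<^bsub>F\<^esub>g\<in>carrier G. a g \<otimes>\<^bsub>F\<^esub> b (inv\<^bsub>G\<^esub> g \<otimes>\<^bsub>G\<^esub> x)),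
     one = (\<lambda>x\<in>carrier G. if x = \<one>\<^bsub>G\<^esub> then \<one>\<^bsub>F\<^esub> else \<zero>\<^bsub>F\<^esub>),
     ring.zero = (\<lambda>x\<in>carrier G. \<zero>\<^bsub>F\<^esub>),
     ring.add = (\<lambda>a b. \<lambda>x\<in>carrier G. a x \<oplus>\<^bsub>F\<^esub> b x),
     module.smult = (\<lambda>c a. \<lambda>x\<in>carrier G. c \<otimes>\<^bsub>F\<^esub> a x)\<rparr>"

text \<open>The group element \<open>g\<close>, regarded as an element of the group algebra.\<close>

definition group_elem ::
    "('f, 'm) ring_scheme \<Rightarrow> ('g, 'n) monoid_scheme \<Rightarrow> 'g \<Rightarrow> 'g \<Rightarrow> 'f" where
  "group_elem F G g = (\<lambda>x\<in>carrier G. if x = g then \<one>\<^bsub>F\<^esub> else \<zero>\<^bsub>F\<^esub>)"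

text \<open>The element written as \<open>C\<close> with an overline: the sum of all elements of \<open>C\<close>.\<close>

definition class_sum ::
    "('f, 'm) ring_scheme \<Rightarrow> ('g, 'n) monoid_scheme \<Rightarrow> 'g set \<Rightarrow> 'g \<Rightarrow> 'f" where
  "class_sum F G C = (\<Oplus>\<^bsub>group_algebra F G\<^esub>g\<in>C. group_elem F G g)"

text \<open>
  The library's \<open>algebra\<close> requires commutativity of the multiplication, and its \<open>subalgebra\<close>
  takes the scalars inside the ring, so neither fits here.
\<close>

definition is_subalgebra ::
    "('f, 'm) ring_scheme \<Rightarrow> ('f, 'a, 'n) module_scheme \<Rightarrow> 'a set \<Rightarrow> bool" where
  "is_subalgebra F A S \<longleftrightarrow> submodule S F A \<and> subring S A"

definition is_basis ::
    "('f, 'm) ring_scheme \<Rightarrow> ('f, 'a, 'n) module_scheme \<Rightarrow> 'a set \<Rightarrow> 'a set \<Rightarrow> bool" where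
  "is_basis F A B S \<longleftrightarrow>
     finite B \<and> B \<subseteq> carrier A \<and>
     (\<forall>c \<in> B \<rightarrow> carrier F.
        (\<Oplus>\<^bsub>A\<^esub>b\<in>B. c b \<odot>\<^bsub>A\<^esub> b) = \<zero>\<^bsub>A\<^esub> \<longrightarrow> (\<forall>b\<in>B. c b = \<zero>\<^bsub>F\<^esub>)) \<and>
     S = {(\<Oplus>\<^bsub>A\<^esub>b\<in>B. c b \<odot>\<^bsub>A\<^esub> b) | c. c \<in> B \<rightarrow> carrier F}"

text \<open>
  \<open>P\<close> is the set of basic sets. Their sums are pairwise distinct, since the basic sets are
  disjoint and nonempty, so that a basis consisting of the set \<open>class_sum F G ` P\<close> is the same
  as a basis indexed by \<open>P\<close>.
\<close>

definition s_ring ::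
    "('f, 'm) ring_scheme \<Rightarrow> ('g, 'n) monoid_scheme \<Rightarrow> ('g \<Rightarrow> 'f) set \<Rightarrow> bool" where
  "s_ring F G S \<longleftrightarrow>
     is_subalgebra F (group_algebra F G) S \<and>
     (\<exists>P. partition_on (carrier G) P \<and> {\<one>\<^bsub>G\<^esub>} \<in> P \<and>
          (\<forall>T\<in>P. set_inv\<^bsub>G\<^esub> T \<in> P) \<and>
          is_basis F (group_algebra F G) (class_sum F G ` P) S)"

definition linear_extension ::
    "('f, 'm) ring_scheme \<Rightarrow> ('g, 'n) monoid_scheme \<Rightarrow> ('g \<Rightarrow> 'g) \<Rightarrow> ('g \<Rightarrow> 'f) \<Rightarrow> 'g \<Rightarrow> 'f" where
  "linear_extension F G \<phi> a =
     (\<Oplus>\<^bsub>group_algebra F G\<^esub>g\<in>carrier G. a g \<odot>\<^bsub>group_algebra F G\<^esub> group_elem F G (\<phi> g))"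

definition cayley_isomorphic ::
    "('f, 'm) ring_scheme \<Rightarrow> ('g, 'n) monoid_scheme \<Rightarrow> ('g \<Rightarrow> 'f) set \<Rightarrow> ('g \<Rightarrow> 'f) set \<Rightarrow> bool"
  where
  "cayley_isomorphic F G S1 S2 \<longleftrightarrow> (\<exists>\<phi>\<in>auto G. linear_extension F G \<phi> ` S1 = S2)"

end

(*
  A subgroup H of G, neither trivial nor all of G, gives the S-ring spanned by 1, H and G, i.e. the
  functions that are constant on H - {1} and on G - H.  An automorphism carries the S-ring of H to
  that of its image, and different subgroups give different S-rings.  So it suffices that a finite
  group in which every automorphism fixes every cyclic subgroup is cyclic.  In the abelian case, an
  element g whose order is the exponent of G splits off with a complement K, and for h in K the map
  that fixes K and sends g to g h^-1 is an automorphism, which moves <g> unless h = 1.  In the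
  nonabelian case every subgroup is normal, so power automorphisms commute and the group has class 2;
  some noncentral y is then centralised or inverted by every element, and g |-> g for g in C(y),
  g |-> g y otherwise, is an automorphism that moves the cyclic subgroup generated by an element
  outside C(y).
*)

theory Submission
  imports Defs "HOL-Combinatorics.Transposition"
begin

section \<open>S-rings from subgroups\<close>

text \<open>The obstacle is the nonabelian case: in the quaternion group, say, every inner
  automorphism fixes every subgroup, so an outer automorphism has to be built, and this is done
  without classifying the groups all of whose subgroups are normal. Multiplying by \<open>y\<close>
  outside the centraliser C(y) is multiplicative as soon as the elements outside C(y) invert
  \<open>y\<close>, because two such factors then cancel. The element \<open>y\<close> is the
  analogue of the quaternion unit i. It is found by minimality of its order: in class 2 one has (z
  y)^k = [y,z]^(k choose 2) z^k y^k, and with a suitable \<open>z\<close> this makes the order of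
  \<open>z y\<close> drop below that of \<open>y\<close> whenever the prime p dividing ord y = p k
  divides k choose 2. The only escape is p = k = 2. Then \<open>y\<close> has order 4, and its
  commutators, which are powers of \<open>y\<close> with square 1, can only be 1 or y^2; these two
  values mean centralised and inverted.\<close>

locale finite_group_algebra = F: field F + G: group G
  for F :: "('f, 'm) ring_scheme" and G :: "('g, 'n) monoid_scheme" +
  assumes finite_carrier: "finite (carrier G)"
begin

abbreviation A where "A \<equiv> group_algebra F G"

section \<open>Pointwise calculus in the group algebra\<close>

lemma group_algebra_simps:
  "carrier A = carrier G \<rightarrow>\<^sub>E carrier F"
  "x \<in> carrier G \<Longrightarrow> \<zero>\<^bsub>A\<^esub> x = \<zero>\<^bsub>F\<^esub>"
  "x \<in> carrier G \<Longrightarrow> \<one>\<^bsub>A\<^esub> x = (if x = \<one>\<^bsub>G\<^esub> then \<one>\<^bsub>F\<^esub> else \<zero>\<^bsub>F\<^esub>)"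
  "x \<in> carrier G \<Longrightarrow> (a \<oplus>\<^bsub>A\<^esub> b) x = a x \<oplus>\<^bsub>F\<^esub> b x"
  "x \<in> carrier G \<Longrightarrow> (c \<odot>\<^bsub>A\<^esub> a) x = c \<otimes>\<^bsub>F\<^esub> a x"
  "x \<in> carrier G \<Longrightarrow>
    (a \<otimes>\<^bsub>A\<^esub> b) x = (\<Oplus>\<^bsub>F\<^esub>g\<in>carrier G. a g \<otimes>\<^bsub>F\<^esub> b (inv\<^bsub>G\<^esub> g \<otimes>\<^bsub>G\<^esub> x))"
  by (simp_all add: group_algebra_def)

lemma coeff_closed [simp]: "a \<in> carrier A \<Longrightarrow> x \<in> carrier G \<Longrightarrow> a x \<in> carrier F"
  by (auto simp: group_algebra_simps)

lemma group_algebra_eqI: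
  "a \<in> carrier A \<Longrightarrow> b \<in> carrier A \<Longrightarrow> (\<And>x. x \<in> carrier G \<Longrightarrow> a x = b x) \<Longrightarrow> a = b"
  unfolding group_algebra_simps by (rule PiE_ext)

lemma group_algebra_add_closed: "a \<in> carrier A \<Longrightarrow> b \<in> carrier A \<Longrightarrow> a \<oplus>\<^bsub>A\<^esub> b \<in> carrier A"
  by (auto simp: group_algebra_def)

lemma group_algebra_zero_closed: "\<zero>\<^bsub>A\<^esub> \<in> carrier A"
  by (auto simp: group_algebra_def)

lemma group_algebra_one_closed: "\<one>\<^bsub>A\<^esub> \<in> carrier A"
  by (auto simp: group_algebra_def)

lemma group_algebra_smult_closed: "c \<in> carrier F \<Longrightarrow> a \<in> carrier A \<Longrightarrow> c \<odot>\<^bsub>A\<^esub> a \<in> carrier A"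
  by (auto simp: group_algebra_def)

lemma group_algebra_mult_closed: "a \<in> carrier A \<Longrightarrow> b \<in> carrier A \<Longrightarrow> a \<otimes>\<^bsub>A\<^esub> b \<in> carrier A"
  by (auto simp: group_algebra_def intro!: F.finsum_closed)

lemma group_algebra_abelian_group: "abelian_group A"
proof (rule abelian_groupI)
  fix a assume a: "a \<in> carrier A"
  have "(\<lambda>x\<in>carrier G. \<ominus>\<^bsub>F\<^esub> a x) \<in> carrier A"
    using a by (auto simp: group_algebra_def)
  moreover from this have "(\<lambda>x\<in>carrier G. \<ominus>\<^bsub>F\<^esub> a x) \<oplus>\<^bsub>A\<^esub> a = \<zero>\<^bsub>A\<^esub>"
    using a by (intro group_algebra_eqI)
      (auto simp: group_algebra_add_closed group_algebra_zero_closed group_algebra_simps(2,4) F.l_neg)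
  ultimately show "\<exists>b\<in>carrier A. b \<oplus>\<^bsub>A\<^esub> a = \<zero>\<^bsub>A\<^esub>" by blast
qed (auto intro!: group_algebra_eqI
      simp: group_algebra_add_closed group_algebra_zero_closed group_algebra_simps(2,4)
        F.add.m_assoc F.add.m_comm F.add.m_lcomm)

sublocale A: abelian_group A
  by (rule group_algebra_abelian_group)

lemma group_algebra_minus_apply:
  assumes "a \<in> carrier A" "x \<in> carrier G"
  shows "(\<ominus>\<^bsub>A\<^esub> a) x = \<ominus>\<^bsub>F\<^esub> a x"
proof -
  have "(\<ominus>\<^bsub>A\<^esub> a) x \<oplus>\<^bsub>F\<^esub> a x = \<zero>\<^bsub>F\<^esub>"
    using assms by (metis A.l_neg group_algebra_simps(2,4))
  then show ?thesis
    using assms by (intro F.minus_equality[symmetric]) auto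
qed

lemma group_algebra_finsum_apply:
  assumes "finite I" "f \<in> I \<rightarrow> carrier A" "x \<in> carrier G"
  shows "(\<Oplus>\<^bsub>A\<^esub>i\<in>I. f i) x = (\<Oplus>\<^bsub>F\<^esub>i\<in>I. f i x)"
  using assms
proof (induction I rule: finite_induct)
  case empty
  then show ?case by (simp add: group_algebra_simps)
next
  case (insert i I)
  then have "f \<in> I \<rightarrow> carrier A" "f i \<in> carrier A" "(\<lambda>i. f i x) \<in> I \<rightarrow> carrier F"
    by (auto simp: Pi_iff)
  with insert show ?case by (simp add: group_algebra_simps(4))
qed

lemma group_elem_closed: "group_elem F G g \<in> carrier A"
  by (auto simp: group_elem_def group_algebra_def)

lemma class_sum_closed: "class_sum F G C \<in> carrier A"
  unfolding class_sum_def by (intro A.finsum_closed) (auto simp: group_elem_closed)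

lemma finsum_delta:
  assumes "C \<subseteq> carrier G" "f \<in> C \<rightarrow> carrier F"
  shows "(\<Oplus>\<^bsub>F\<^esub>g\<in>C. if x = g then f g else \<zero>\<^bsub>F\<^esub>) = (if x \<in> C then f x else \<zero>\<^bsub>F\<^esub>)"
proof (cases "x \<in> C")
  case True
  then show ?thesis
    using F.finsum_singleton[of x C f] assms finite_subset[OF _ finite_carrier] by simp
next
  case False
  then show ?thesis
    by (auto intro!: F.add.finprod_one_eqI)
qed

lemma class_sum_apply:
  assumes "C \<subseteq> carrier G" "x \<in> carrier G"
  shows "class_sum F G C x = (if x \<in> C then \<one>\<^bsub>F\<^esub> else \<zero>\<^bsub>F\<^esub>)"
proof -
  have "class_sum F G C x = (\<Oplus>\<^bsub>F\<^esub>g\<in>C. group_elem F G g x)"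
    unfolding class_sum_def using assms finite_subset[OF _ finite_carrier]
    by (intro group_algebra_finsum_apply) (auto simp: group_elem_closed)
  also have "\<dots> = (\<Oplus>\<^bsub>F\<^esub>g\<in>C. if x = g then \<one>\<^bsub>F\<^esub> else \<zero>\<^bsub>F\<^esub>)"
    using assms by (intro F.finsum_cong') (auto simp: group_elem_def)
  finally show ?thesis
    using finsum_delta[of C "\<lambda>_. \<one>\<^bsub>F\<^esub>" x] assms by simp
qed

section \<open>S-rings as functions constant on the blocks of a partition\<close>

context
  fixes P assumes part: "partition_on (carrier G) P"
begin

lemma partition_block_subset: "T \<in> P \<Longrightarrow> T \<subseteq> carrier G"
  using part by (auto simp: partition_on_def)

lemma block_unique: "T \<in> P \<Longrightarrow> U \<in> P \<Longrightarrow> x \<in> T \<Longrightarrow> x \<in> U \<Longrightarrow> T = U"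
  using part unfolding partition_on_def disjoint_def by blast

lemma finite_blocks: "finite P"
  by (rule finite_elements[OF finite_carrier part])

lemma inj_on_class_sum: "inj_on (class_sum F G) P"
proof (rule inj_onI)
  fix T U assume TU: "T \<in> P" "U \<in> P" "class_sum F G T = class_sum F G U"
  obtain x where "x \<in> T"
    using part TU(1) by (metis partition_on_def equals0I)
  moreover have "x \<in> U"
    using TU \<open>x \<in> T\<close> class_sum_apply[of T x] class_sum_apply[of U x] partition_block_subset
    by (metis F.zero_not_one subsetD)
  ultimately show "T = U"
    using \<open>x \<in> T\<close> TU block_unique by blast
qed

text \<open>At a point \<open>x\<close> only the block containing \<open>x\<close> contributes, so
  coefficients can be read off by evaluation. Linear independence and the description of the span
  both rest on this.\<close>

lemma class_sum_combination_apply: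
  assumes c: "c \<in> class_sum F G ` P \<rightarrow> carrier F" and T: "T \<in> P" "x \<in> T"
  shows "(\<Oplus>\<^bsub>A\<^esub>b\<in>class_sum F G ` P. c b \<odot>\<^bsub>A\<^esub> b) x = c (class_sum F G T)"
proof -
  have x: "x \<in> carrier G"
    using partition_block_subset T by blast
  have "(\<Oplus>\<^bsub>A\<^esub>b\<in>class_sum F G ` P. c b \<odot>\<^bsub>A\<^esub> b) x = (\<Oplus>\<^bsub>F\<^esub>b\<in>class_sum F G ` P. c b \<otimes>\<^bsub>F\<^esub> b x)"
    using x c finite_blocks
    by (subst group_algebra_finsum_apply)
      (auto simp: group_algebra_simps(5) Pi_iff intro!: group_algebra_smult_closed class_sum_closed)
  also have "\<dots> = (\<Oplus>\<^bsub>F\<^esub>U\<in>P. c (class_sum F G U) \<otimes>\<^bsub>F\<^esub> class_sum F G U x)"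
    using x c by (intro F.finsum_reindex inj_on_class_sum) (auto simp: class_sum_closed Pi_iff)
  also have "\<dots> = (\<Oplus>\<^bsub>F\<^esub>U\<in>P. if T = U then c (class_sum F G U) else \<zero>\<^bsub>F\<^esub>)"
  proof (intro F.finsum_cong')
    fix U assume U: "U \<in> P"
    then have "x \<in> U \<longleftrightarrow> T = U"
      using block_unique T by blast
    then show "c (class_sum F G U) \<otimes>\<^bsub>F\<^esub> class_sum F G U x = (if T = U then c (class_sum F G U) else \<zero>\<^bsub>F\<^esub>)"
      using U x c partition_block_subset by (simp add: class_sum_apply Pi_iff)
  qed (use c in auto)
  also have "\<dots> = c (class_sum F G T)"
    using c T finite_blocks by (intro F.finsum_singleton) auto
  finally show ?thesis .
qed

lemma class_sums_basis:
  "is_basis F A (class_sum F G ` P) {a \<in> carrier A. \<forall>T\<in>P. \<forall>x\<in>T. \<forall>y\<in>T. a x = a y}"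
proof -
  let ?B = "class_sum F G ` P"
  let ?comb = "\<lambda>c. \<Oplus>\<^bsub>A\<^esub>b\<in>?B. c b \<odot>\<^bsub>A\<^esub> b"
  have comb_closed: "?comb c \<in> carrier A" if "c \<in> ?B \<rightarrow> carrier F" for c
    using that by (intro A.finsum_closed) (auto intro!: group_algebra_smult_closed class_sum_closed)
  have indep: "c (class_sum F G T) = \<zero>\<^bsub>F\<^esub>"
    if c: "c \<in> ?B \<rightarrow> carrier F" "?comb c = \<zero>\<^bsub>A\<^esub>" and T: "T \<in> P" for c T
  proof -
    obtain x where "x \<in> T"
      using part T by (metis partition_on_def equals0I)
    then show ?thesis
      using class_sum_combination_apply[OF c(1) T, of x] c(2) partition_block_subset[OF T]
      by (auto simp: group_algebra_simps(2))
  qed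
  have spanned: "\<exists>c\<in>?B \<rightarrow> carrier F. a = ?comb c"
    if a: "a \<in> carrier A" "\<forall>T\<in>P. \<forall>x\<in>T. \<forall>y\<in>T. a x = a y" for a
  proof -
    \<comment> \<open>The coefficient is the value of \<open>a\<close> at a chosen point of the
      block. Coefficients are indexed by class sums, so \<open>inv_into\<close> first recovers the
      block from its sum.\<close>
    define c where "c = (\<lambda>b. a (SOME x. x \<in> inv_into P (class_sum F G) b))"
    have rep: "(SOME x. x \<in> T) \<in> T" if "T \<in> P" for T
      using part that by (metis partition_on_def someI_ex ex_in_conv)
    have c_eq: "c (class_sum F G T) = a (SOME x. x \<in> T)" if "T \<in> P" for T
      using that inj_on_class_sum by (simp add: c_def inv_into_f_f)
    have c: "c \<in> ?B \<rightarrow> carrier F"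
      using rep partition_block_subset a(1) by (fastforce simp: c_eq)
    moreover have "a = ?comb c"
    proof (rule group_algebra_eqI[OF a(1) comb_closed[OF c]])
      fix x assume "x \<in> carrier G"
      then obtain T where T: "T \<in> P" "x \<in> T"
        using part by (auto simp: partition_on_def)
      have "?comb c x = a (SOME x. x \<in> T)"
        using class_sum_combination_apply[OF c T] c_eq[OF T(1)] by simp
      then show "a x = ?comb c x"
        using a(2) rep T by metis
    qed
    ultimately show ?thesis by blast
  qed
  have comb_const: "?comb c x = ?comb c y"
    if "c \<in> ?B \<rightarrow> carrier F" "T \<in> P" "x \<in> T" "y \<in> T" for c T x y
    using class_sum_combination_apply[OF that(1,2,3)] class_sum_combination_apply[OF that(1,2,4)]
    by simp
  have "{a \<in> carrier A. \<forall>T\<in>P. \<forall>x\<in>T. \<forall>y\<in>T. a x = a y} = {?comb c | c. c \<in> ?B \<rightarrow> carrier F}"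
    (is "?S = ?C")
  proof (intro subset_antisym subsetI)
    fix a assume "a \<in> ?S"
    then have "a \<in> carrier A \<and> (\<forall>T\<in>P. \<forall>x\<in>T. \<forall>y\<in>T. a x = a y)"
      by (rule CollectD)
    from spanned[OF conjunct1[OF this] conjunct2[OF this]] show "a \<in> ?C" by blast
  next
    fix a assume "a \<in> ?C"
    then obtain c where c: "c \<in> ?B \<rightarrow> carrier F" "a = ?comb c" by blast
    show "a \<in> ?S"
      unfolding c(2)
      by (intro CollectI conjI ballI comb_closed[OF c(1)]) (rule comb_const[OF c(1)])
  qed
  then show ?thesis
    unfolding is_basis_def using finite_blocks indep
    by (intro conjI ballI impI) (auto simp: class_sum_closed)
qed

text \<open>The linear conditions hold pointwise and the unit is constant on blocks because
  \<open>{1}\<close> is one of them; for a concrete partition this leaves inverses and the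
  convolution product to check.\<close>

lemma s_ring_of_partition:
  assumes one: "{\<one>\<^bsub>G\<^esub>} \<in> P" and inv: "\<And>T. T \<in> P \<Longrightarrow> set_inv\<^bsub>G\<^esub> T \<in> P"
    and S: "S = {a \<in> carrier A. \<forall>T\<in>P. \<forall>x\<in>T. \<forall>y\<in>T. a x = a y}"
    and mult: "\<And>a b. a \<in> S \<Longrightarrow> b \<in> S \<Longrightarrow> a \<otimes>\<^bsub>A\<^esub> b \<in> S"
  shows "s_ring F G S"
proof -
  have block: "x \<in> carrier G" if "T \<in> P" "x \<in> T" for T x
    using that partition_block_subset by blast
  have "\<one>\<^bsub>G\<^esub> \<notin> T" if "T \<in> P" "T \<noteq> {\<one>\<^bsub>G\<^esub>}" for T
    using block_unique[OF one] that by blast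
  then have one_S: "\<one>\<^bsub>A\<^esub> \<in> S"
    unfolding S using block
    by (auto simp: group_algebra_one_closed group_algebra_simps(3))
  have SI: "a \<in> S" if "a \<in> carrier A" "\<And>T x y. T \<in> P \<Longrightarrow> x \<in> T \<Longrightarrow> y \<in> T \<Longrightarrow> a x = a y" for a
    using that unfolding S by blast
  have SD: "a \<in> carrier A" "T \<in> P \<Longrightarrow> x \<in> T \<Longrightarrow> y \<in> T \<Longrightarrow> a x = a y" if "a \<in> S" for a T x y
    using that unfolding S by blast+
  have sub: "subgroup S (add_monoid A)"
  proof (rule A.add.subgroupI)
    show "S \<subseteq> carrier A" "S \<noteq> {}"
      using one_S SD by auto
    show "\<ominus>\<^bsub>A\<^esub> a \<in> S" if a: "a \<in> S" for a
    proof (rule SI)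
      fix T x y assume T: "T \<in> P" "x \<in> T" "y \<in> T"
      show "(\<ominus>\<^bsub>A\<^esub> a) x = (\<ominus>\<^bsub>A\<^esub> a) y"
        using SD(2)[OF a T] SD(1)[OF a] block[OF T(1,2)] block[OF T(1,3)]
        by (simp add: group_algebra_minus_apply)
    qed (simp add: SD(1)[OF a])
    show "a \<oplus>\<^bsub>A\<^esub> b \<in> S" if ab: "a \<in> S" "b \<in> S" for a b
    proof (rule SI)
      fix T x y assume T: "T \<in> P" "x \<in> T" "y \<in> T"
      show "(a \<oplus>\<^bsub>A\<^esub> b) x = (a \<oplus>\<^bsub>A\<^esub> b) y"
        using SD(2)[OF ab(1) T] SD(2)[OF ab(2) T] block[OF T(1,2)] block[OF T(1,3)]
        by (simp add: group_algebra_simps(4))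
    qed (simp add: SD(1)[OF ab(1)] SD(1)[OF ab(2)])
  qed
  have "c \<odot>\<^bsub>A\<^esub> a \<in> S" if c: "c \<in> carrier F" and a: "a \<in> S" for c a
  proof (rule SI)
    fix T x y assume T: "T \<in> P" "x \<in> T" "y \<in> T"
    show "(c \<odot>\<^bsub>A\<^esub> a) x = (c \<odot>\<^bsub>A\<^esub> a) y"
      using SD(2)[OF a T] block[OF T(1,2)] block[OF T(1,3)] by (simp add: group_algebra_simps(5))
  qed (rule group_algebra_smult_closed[OF c SD(1)[OF a]])
  then have "submodule S F A"
    using sub by (intro submodule.intro submodule_axioms.intro)
  moreover have "subring S A"
    using sub one_S mult
    by (intro subring.intro submonoid.intro) (auto dest: SD(1))
  ultimately show ?thesis
    unfolding s_ring_def is_subalgebra_def using part one inv class_sums_basis S by blast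
qed

end

section \<open>The S-ring of a subgroup\<close>

text \<open>The value at the identity is left free, so the basic sets are \<open>{1}\<close>,
  \<open>H - {1}\<close> and \<open>G - H\<close>. For normal \<open>H\<close> this is the wreath
  product of the trivial S-rings over \<open>H\<close> and over the quotient by
  \<open>H\<close>.\<close>

definition subgroup_s_ring :: "'g set \<Rightarrow> ('g \<Rightarrow> 'f) set" where
  "subgroup_s_ring H = {a \<in> carrier A.
     (\<forall>x\<in>H - {\<one>\<^bsub>G\<^esub>}. \<forall>y\<in>H - {\<one>\<^bsub>G\<^esub>}. a x = a y) \<and>
     (\<forall>x\<in>carrier G - H. \<forall>y\<in>carrier G - H. a x = a y)}"

lemma subgroup_s_ringI:
  assumes "a \<in> carrier A"
    and "\<And>x y. x \<in> H - {\<one>\<^bsub>G\<^esub>} \<Longrightarrow> y \<in> H - {\<one>\<^bsub>G\<^esub>} \<Longrightarrow> a x = a y"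
    and "\<And>x y. x \<in> carrier G - H \<Longrightarrow> y \<in> carrier G - H \<Longrightarrow> a x = a y"
  shows "a \<in> subgroup_s_ring H"
  unfolding subgroup_s_ring_def using assms by (intro CollectI conjI ballI)

lemma subgroup_s_ringD:
  assumes "a \<in> subgroup_s_ring H"
  shows "a \<in> carrier A"
    and "x \<in> H - {\<one>\<^bsub>G\<^esub>} \<Longrightarrow> y \<in> H - {\<one>\<^bsub>G\<^esub>} \<Longrightarrow> a x = a y"
    and "x \<in> carrier G - H \<Longrightarrow> y \<in> carrier G - H \<Longrightarrow> a x = a y"
proof -
  note a = assms[unfolded subgroup_s_ring_def mem_Collect_eq]
  show "a \<in> carrier A" using a by (rule conjunct1)
  show "a x = a y" if "x \<in> H - {\<one>\<^bsub>G\<^esub>}" "y \<in> H - {\<one>\<^bsub>G\<^esub>}"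
    using conjunct1[OF conjunct2[OF a], rule_format, OF that] .
  show "a x = a y" if "x \<in> carrier G - H" "y \<in> carrier G - H"
    using conjunct2[OF conjunct2[OF a], rule_format, OF that] .
qed

text \<open>Swapping the summation indices \<open>x\<close> and \<open>y\<close> turns the sum at
  \<open>y\<close> into the sum at \<open>x\<close> term by term: \<open>a\<close> does not
  distinguish \<open>x\<close> from \<open>y\<close>, and the two arguments of \<open>b\<close>
  always lie in the same basic set.\<close>

lemma convolution_const_on_subgroup:
  assumes H: "subgroup H G" and ab: "a \<in> subgroup_s_ring H" "b \<in> subgroup_s_ring H"
    and xy: "x \<in> H - {\<one>\<^bsub>G\<^esub>}" "y \<in> H - {\<one>\<^bsub>G\<^esub>}"
  shows "(a \<otimes>\<^bsub>A\<^esub> b) x = (a \<otimes>\<^bsub>A\<^esub> b) y"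
proof -
  let ?t = "transpose x y"
  have HG: "h \<in> carrier G" if "h \<in> H" for h
    using subgroup.mem_carrier[OF H that] .
  have xyG: "x \<in> carrier G" "y \<in> carrier G"
    using xy HG by auto
  note a = subgroup_s_ringD(1)[OF ab(1)] subgroup_s_ringD(1)[OF ab(2)]
  have "?t permutes carrier G"
    using xyG by (intro permutes_swap_id)
  then have img: "?t ` carrier G = carrier G"
    by (rule permutes_image)
  have terms: "a (?t g) \<otimes>\<^bsub>F\<^esub> b (inv\<^bsub>G\<^esub> (?t g) \<otimes>\<^bsub>G\<^esub> y) = a g \<otimes>\<^bsub>F\<^esub> b (inv\<^bsub>G\<^esub> g \<otimes>\<^bsub>G\<^esub> x)"
    if g: "g \<in> carrier G" for g
  proof -
    have "a (?t g) = a g"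
      using subgroup_s_ringD(2)[OF ab(1) xy] by (simp add: transpose_def)
    moreover have "b (inv\<^bsub>G\<^esub> (?t g) \<otimes>\<^bsub>G\<^esub> y) = b (inv\<^bsub>G\<^esub> g \<otimes>\<^bsub>G\<^esub> x)"
    proof -
      have ne: "inv\<^bsub>G\<^esub> u \<otimes>\<^bsub>G\<^esub> v \<noteq> \<one>\<^bsub>G\<^esub>" if "u \<in> carrier G" "v \<in> carrier G" "u \<noteq> v" for u v
        using that by (metis G.inv_equality G.inv_inv G.inv_closed)
      have memH: "inv\<^bsub>G\<^esub> u \<otimes>\<^bsub>G\<^esub> v \<in> H \<longleftrightarrow> u \<in> H" if "u \<in> carrier G" "v \<in> H" for u v
      proof
        assume "inv\<^bsub>G\<^esub> u \<otimes>\<^bsub>G\<^esub> v \<in> H"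
        then have "(inv\<^bsub>G\<^esub> u \<otimes>\<^bsub>G\<^esub> v) \<otimes>\<^bsub>G\<^esub> inv\<^bsub>G\<^esub> v \<in> H"
          using that H by (simp add: subgroup.m_closed subgroup.m_inv_closed)
        then have "inv\<^bsub>G\<^esub> u \<in> H"
          using that HG by (simp add: G.m_assoc)
        then show "u \<in> H"
          using that H by (metis G.inv_inv subgroup.m_inv_closed)
      qed (use that H in \<open>simp add: subgroup.m_closed subgroup.m_inv_closed\<close>)
      \<comment> \<open>For \<open>g = x\<close> both arguments of \<open>b\<close> are the
        identity; for \<open>g = y\<close> they are mutually inverse elements of
        \<open>H - {1}\<close>; otherwise both differ from the identity and lie in \<open>H\<close>
        exactly when \<open>g\<close> does.\<close>
      consider "g = x" | "g = y" "g \<noteq> x" | "g \<noteq> x" "g \<noteq> y" by blast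
      then show ?thesis
      proof cases
        case 1
        then show ?thesis using xyG by simp
      next
        case 2
        then have "inv\<^bsub>G\<^esub> x \<otimes>\<^bsub>G\<^esub> y \<in> H - {\<one>\<^bsub>G\<^esub>}" "inv\<^bsub>G\<^esub> y \<otimes>\<^bsub>G\<^esub> x \<in> H - {\<one>\<^bsub>G\<^esub>}"
          using xy xyG ne memH by auto
        then have "b (inv\<^bsub>G\<^esub> x \<otimes>\<^bsub>G\<^esub> y) = b (inv\<^bsub>G\<^esub> y \<otimes>\<^bsub>G\<^esub> x)"
          by (rule subgroup_s_ringD(2)[OF ab(2)])
        with 2 show ?thesis by simp
      next
        case 3
        then have "inv\<^bsub>G\<^esub> g \<otimes>\<^bsub>G\<^esub> y \<in> H - {\<one>\<^bsub>G\<^esub>} \<and> inv\<^bsub>G\<^esub> g \<otimes>\<^bsub>G\<^esub> x \<in> H - {\<one>\<^bsub>G\<^esub>} \<or>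
          inv\<^bsub>G\<^esub> g \<otimes>\<^bsub>G\<^esub> y \<in> carrier G - H \<and> inv\<^bsub>G\<^esub> g \<otimes>\<^bsub>G\<^esub> x \<in> carrier G - H"
          using g xy xyG ne memH by auto
        then have "b (inv\<^bsub>G\<^esub> g \<otimes>\<^bsub>G\<^esub> y) = b (inv\<^bsub>G\<^esub> g \<otimes>\<^bsub>G\<^esub> x)"
          by (elim disjE conjE) (rule subgroup_s_ringD(2,3)[OF ab(2)]; assumption)+
        with 3 show ?thesis by simp
      qed
    qed
    ultimately show ?thesis by simp
  qed
  have "(a \<otimes>\<^bsub>A\<^esub> b) y = (\<Oplus>\<^bsub>F\<^esub>g\<in>?t ` carrier G. a g \<otimes>\<^bsub>F\<^esub> b (inv\<^bsub>G\<^esub> g \<otimes>\<^bsub>G\<^esub> y))"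
    using xyG by (simp add: group_algebra_simps(6) img)
  also have "\<dots> = (\<Oplus>\<^bsub>F\<^esub>g\<in>carrier G. a (?t g) \<otimes>\<^bsub>F\<^esub> b (inv\<^bsub>G\<^esub> (?t g) \<otimes>\<^bsub>G\<^esub> y))"
    using a xyG by (intro F.finsum_reindex) (auto simp: img)
  also have "\<dots> = (\<Oplus>\<^bsub>F\<^esub>g\<in>carrier G. a g \<otimes>\<^bsub>F\<^esub> b (inv\<^bsub>G\<^esub> g \<otimes>\<^bsub>G\<^esub> x))"
    using a xyG terms by (intro F.finsum_cong') auto
  finally show ?thesis
    using xyG by (simp add: group_algebra_simps(6))
qed

text \<open>The point of the formula is that its right-hand side is free of \<open>x\<close>. For
  \<open>g\<close> in \<open>H\<close> the argument of \<open>b\<close> falls outside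
  \<open>H\<close>, so \<open>b\<close> contributes \<open>b u\<close>; for the other
  \<open>g\<close> the factor \<open>a g\<close> is \<open>a u\<close>. What remains is a sum of
  values of \<open>b\<close>, computed as the total over \<open>G\<close> minus \<open>|H|\<close>
  copies of \<open>b u\<close>.\<close>

lemma convolution_outside_subgroup:
  assumes H: "subgroup H G" and ab: "a \<in> subgroup_s_ring H" "b \<in> subgroup_s_ring H"
    and u: "u \<in> carrier G - H" and x: "x \<in> carrier G - H"
  shows "(a \<otimes>\<^bsub>A\<^esub> b) x = (\<Oplus>\<^bsub>F\<^esub>g\<in>H. a g \<otimes>\<^bsub>F\<^esub> b u) \<oplus>\<^bsub>F\<^esub>
    a u \<otimes>\<^bsub>F\<^esub> ((\<Oplus>\<^bsub>F\<^esub>g\<in>carrier G. b g) \<ominus>\<^bsub>F\<^esub> (\<Oplus>\<^bsub>F\<^esub>g\<in>H. b u))"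
proof -
  let ?f = "\<lambda>g. inv\<^bsub>G\<^esub> g \<otimes>\<^bsub>G\<^esub> x"
  have HG: "H \<subseteq> carrier G"
    using subgroup.subset[OF H] .
  have fin: "finite H" "finite (carrier G - H)"
    using finite_subset[OF HG finite_carrier] finite_carrier by auto
  have un: "H \<union> (carrier G - H) = carrier G"
    using HG by blast
  note a = subgroup_s_ringD(1)[OF ab(1)] subgroup_s_ringD(1)[OF ab(2)]
  have outside: "?f g \<in> carrier G - H" if "g \<in> H" for g
  proof -
    have "g \<otimes>\<^bsub>G\<^esub> ?f g = x"
      using that x HG by (auto simp: G.m_assoc[symmetric])
    then have "?f g \<notin> H"
      using that x H by (metis DiffD2 subgroup.m_closed)
    then show ?thesis using that x HG by auto
  qed
  have inj: "inj_on ?f (carrier G)"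
    using x by (auto intro!: inj_onI)
  then have img: "?f ` carrier G = carrier G"
    using x by (intro endo_inj_surj finite_carrier) auto
  have split: "(\<Oplus>\<^bsub>F\<^esub>g\<in>carrier G. h g) = (\<Oplus>\<^bsub>F\<^esub>g\<in>H. h g) \<oplus>\<^bsub>F\<^esub> (\<Oplus>\<^bsub>F\<^esub>g\<in>carrier G - H. h g)"
    if "h \<in> carrier G \<rightarrow> carrier F" for h
    using F.finsum_Un_disjoint[OF fin, of h] that HG un by (auto simp: Pi_iff)
  have bH: "(\<Oplus>\<^bsub>F\<^esub>g\<in>H. b (?f g)) = (\<Oplus>\<^bsub>F\<^esub>g\<in>H. b u)"
    using u a outside by (intro F.finsum_cong' subgroup_s_ringD(3)[OF ab(2)]) auto
  have "(\<Oplus>\<^bsub>F\<^esub>g\<in>carrier G. b g) = (\<Oplus>\<^bsub>F\<^esub>g\<in>carrier G. b (?f g))"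
    using F.finsum_reindex[of b ?f "carrier G"] a inj by (simp add: img Pi_iff)
  also have "\<dots> = (\<Oplus>\<^bsub>F\<^esub>g\<in>H. b u) \<oplus>\<^bsub>F\<^esub> (\<Oplus>\<^bsub>F\<^esub>g\<in>carrier G - H. b (?f g))"
    using a x by (subst split) (auto simp: bH)
  finally have total: "(\<Oplus>\<^bsub>F\<^esub>g\<in>carrier G. b g) =
      (\<Oplus>\<^bsub>F\<^esub>g\<in>H. b u) \<oplus>\<^bsub>F\<^esub> (\<Oplus>\<^bsub>F\<^esub>g\<in>carrier G - H. b (?f g))" .
  have closed: "(\<Oplus>\<^bsub>F\<^esub>g\<in>H. b u) \<in> carrier F" "(\<Oplus>\<^bsub>F\<^esub>g\<in>carrier G - H. b (?f g)) \<in> carrier F"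
    using a u x by (auto intro!: F.finsum_closed)
  have rest: "(\<Oplus>\<^bsub>F\<^esub>g\<in>carrier G - H. b (?f g)) = (\<Oplus>\<^bsub>F\<^esub>g\<in>carrier G. b g) \<ominus>\<^bsub>F\<^esub> (\<Oplus>\<^bsub>F\<^esub>g\<in>H. b u)"
    unfolding total using closed by (simp add: F.minus_eq F.add.m_comm[of "finsum F _ H"] F.add.m_assoc F.r_neg)
  have "(a \<otimes>\<^bsub>A\<^esub> b) x = (\<Oplus>\<^bsub>F\<^esub>g\<in>H. a g \<otimes>\<^bsub>F\<^esub> b (?f g)) \<oplus>\<^bsub>F\<^esub> (\<Oplus>\<^bsub>F\<^esub>g\<in>carrier G - H. a g \<otimes>\<^bsub>F\<^esub> b (?f g))"
    using a x by (simp add: group_algebra_simps(6) split)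
  also have "(\<Oplus>\<^bsub>F\<^esub>g\<in>H. a g \<otimes>\<^bsub>F\<^esub> b (?f g)) = (\<Oplus>\<^bsub>F\<^esub>g\<in>H. a g \<otimes>\<^bsub>F\<^esub> b u)"
  proof (rule F.finsum_cong')
    fix g assume "g \<in> H"
    then have "b (?f g) = b u"
      using outside u by (intro subgroup_s_ringD(3)[OF ab(2)])
    then show "a g \<otimes>\<^bsub>F\<^esub> b (?f g) = a g \<otimes>\<^bsub>F\<^esub> b u" by simp
  qed (use a u HG in auto)
  also have "(\<Oplus>\<^bsub>F\<^esub>g\<in>carrier G - H. a g \<otimes>\<^bsub>F\<^esub> b (?f g)) = (\<Oplus>\<^bsub>F\<^esub>g\<in>carrier G - H. a u \<otimes>\<^bsub>F\<^esub> b (?f g))"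
  proof (rule F.finsum_cong')
    fix g assume "g \<in> carrier G - H"
    then have "a g = a u"
      using u by (intro subgroup_s_ringD(3)[OF ab(1)])
    then show "a g \<otimes>\<^bsub>F\<^esub> b (?f g) = a u \<otimes>\<^bsub>F\<^esub> b (?f g)" by simp
  qed (use a u x in auto)
  also have "\<dots> = a u \<otimes>\<^bsub>F\<^esub> (\<Oplus>\<^bsub>F\<^esub>g\<in>carrier G - H. b (?f g))"
    using a u x fin by (intro F.finsum_rdistr[symmetric]) auto
  finally show ?thesis
    by (simp add: rest)
qed

lemma subgroup_s_ring:
  assumes H: "subgroup H G" "H \<noteq> {\<one>\<^bsub>G\<^esub>}" "H \<noteq> carrier G"
  shows "s_ring F G (subgroup_s_ring H)"
proof (rule s_ring_of_partition)
  let ?P = "{{\<one>\<^bsub>G\<^esub>}, H - {\<one>\<^bsub>G\<^esub>}, carrier G - H}"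
  have HG: "H \<subseteq> carrier G" "\<one>\<^bsub>G\<^esub> \<in> H"
    using subgroup.subset[OF H(1)] subgroup.one_closed[OF H(1)] by auto
  show "partition_on (carrier G) ?P"
    using H HG by (auto simp: partition_on_def disjoint_def)
  show "{\<one>\<^bsub>G\<^esub>} \<in> ?P" by simp
  have inv_H: "inv\<^bsub>G\<^esub> x \<in> H \<longleftrightarrow> x \<in> H" if "x \<in> carrier G" for x
    using that H(1) by (metis G.inv_inv subgroup.m_inv_closed)
  have set_inv: "set_inv\<^bsub>G\<^esub> T = {x \<in> carrier G. inv\<^bsub>G\<^esub> x \<in> T}" if "T \<subseteq> carrier G" for T
    using that by (force simp: SET_INV_def)
  have "set_inv\<^bsub>G\<^esub> {\<one>\<^bsub>G\<^esub>} = {\<one>\<^bsub>G\<^esub>}" "set_inv\<^bsub>G\<^esub> (H - {\<one>\<^bsub>G\<^esub>}) = H - {\<one>\<^bsub>G\<^esub>}"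
    "set_inv\<^bsub>G\<^esub> (carrier G - H) = carrier G - H"
    using HG by (auto simp: set_inv inv_H subset_iff)
  then show "set_inv\<^bsub>G\<^esub> T \<in> ?P" if "T \<in> ?P" for T
    using that by auto
  show "subgroup_s_ring H = {a \<in> carrier A. \<forall>T\<in>?P. \<forall>x\<in>T. \<forall>y\<in>T. a x = a y}"
    by (auto simp: subgroup_s_ring_def)
  show "a \<otimes>\<^bsub>A\<^esub> b \<in> subgroup_s_ring H" if ab: "a \<in> subgroup_s_ring H" "b \<in> subgroup_s_ring H" for a b
  proof (rule subgroup_s_ringI)
    show "a \<otimes>\<^bsub>A\<^esub> b \<in> carrier A"
      using subgroup_s_ringD(1)[OF ab(1)] subgroup_s_ringD(1)[OF ab(2)]
      by (rule group_algebra_mult_closed)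
    show "(a \<otimes>\<^bsub>A\<^esub> b) x = (a \<otimes>\<^bsub>A\<^esub> b) y" if "x \<in> H - {\<one>\<^bsub>G\<^esub>}" "y \<in> H - {\<one>\<^bsub>G\<^esub>}" for x y
      using convolution_const_on_subgroup[OF H(1) ab that] .
    \<comment> \<open>Both sides are evaluated with the reference point \<open>u\<close> taken to be
      \<open>x\<close>.\<close>
    show "(a \<otimes>\<^bsub>A\<^esub> b) x = (a \<otimes>\<^bsub>A\<^esub> b) y" if "x \<in> carrier G - H" "y \<in> carrier G - H" for x y
      using convolution_outside_subgroup[OF H(1) ab that(1)] that by simp
  qed
qed

lemma class_sum_in_subgroup_s_ring: "H \<subseteq> carrier G \<Longrightarrow> class_sum F G H \<in> subgroup_s_ring H"
  by (intro subgroup_s_ringI) (auto simp: class_sum_closed class_sum_apply subset_iff)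

text \<open>The class sum of \<open>H\<close> is constant off \<open>K\<close> if it lies in the
  S-ring of \<open>K\<close>. A point of \<open>H\<close> outside \<open>K\<close> makes this
  constant 1, so \<open>H\<close> contains the complement of \<open>K\<close> and \<open>G\<close>
  becomes a union of two proper subgroups.\<close>

lemma subgroup_s_ring_inj:
  assumes "subgroup H G" "subgroup K G" "H \<noteq> carrier G" "K \<noteq> carrier G"
    and eq: "subgroup_s_ring H = subgroup_s_ring K"
  shows "H = K"
proof -
  have "H \<subseteq> K" if H: "subgroup H G" "H \<noteq> carrier G" and K: "subgroup K G"
    and eq: "subgroup_s_ring H = subgroup_s_ring K" for H K
  proof (rule ccontr)
    assume "\<not> H \<subseteq> K"
    then obtain x where x: "x \<in> H" "x \<notin> K" by blast
    have HG: "H \<subseteq> carrier G"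
      using subgroup.subset[OF H(1)] .
    have "class_sum F G H \<in> subgroup_s_ring K"
      using class_sum_in_subgroup_s_ring[OF HG] eq by simp
    then have "class_sum F G H y = class_sum F G H x" if "y \<in> carrier G" "y \<notin> K" for y
      using that x HG by (intro subgroup_s_ringD(3)[where H = K]) auto
    then have cover: "y \<in> H" if "y \<in> carrier G" "y \<notin> K" for y
      using that x HG by (metis class_sum_apply F.zero_not_one subsetD)
    obtain y where y: "y \<in> carrier G" "y \<notin> H"
      using H HG by blast
    then have "y \<in> K" using cover by blast
    \<comment> \<open>With \<open>x\<close> in \<open>H - K\<close> and \<open>y\<close> in
      \<open>K - H\<close>, the product lies in neither subgroup, although the two cover
      \<open>G\<close>.\<close>
    have xy: "x \<in> carrier G" "inv\<^bsub>G\<^esub> x \<otimes>\<^bsub>G\<^esub> (x \<otimes>\<^bsub>G\<^esub> y) = y" "(x \<otimes>\<^bsub>G\<^esub> y) \<otimes>\<^bsub>G\<^esub> inv\<^bsub>G\<^esub> y = x"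
      using x HG y by (auto simp: G.m_assoc G.m_assoc[symmetric])
    have "x \<otimes>\<^bsub>G\<^esub> y \<notin> K"
      using xy(3) x(2) \<open>y \<in> K\<close> K by (metis subgroup.m_closed subgroup.m_inv_closed)
    then have "x \<otimes>\<^bsub>G\<^esub> y \<in> H"
      using cover xy(1) y by blast
    then show False
      using xy(2) x(1) y(2) H(1) by (metis subgroup.m_closed subgroup.m_inv_closed)
  qed
  with assms show ?thesis by blast
qed

section \<open>The action of automorphisms on these S-rings\<close>

text \<open>The linear extension is composition with the inverse of \<open>\<phi>\<close>;
  evaluating at points \<open>\<phi> g\<close> keeps the inverse out of sight.\<close>

lemma linear_extension_apply:
  assumes phi: "\<phi> \<in> auto G" and a: "a \<in> carrier A"
  shows "linear_extension F G \<phi> a \<in> carrier A"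
    and "g \<in> carrier G \<Longrightarrow> linear_extension F G \<phi> a (\<phi> g) = a g"
proof -
  have bij: "bij_betw \<phi> (carrier G) (carrier G)"
    using phi by (auto simp: auto_def Bij_def)
  have closed: "a g \<odot>\<^bsub>A\<^esub> group_elem F G (\<phi> g) \<in> carrier A" if "g \<in> carrier G" for g
    using that a by (intro group_algebra_smult_closed group_elem_closed) auto
  then show "linear_extension F G \<phi> a \<in> carrier A"
    unfolding linear_extension_def by (intro A.finsum_closed) auto
  assume g: "g \<in> carrier G"
  then have \<phi>g: "\<phi> g \<in> carrier G"
    using bij by (auto simp: bij_betw_def)
  have "linear_extension F G \<phi> a (\<phi> g) =
      (\<Oplus>\<^bsub>F\<^esub>h\<in>carrier G. (a h \<odot>\<^bsub>A\<^esub> group_elem F G (\<phi> h)) (\<phi> g))"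
    unfolding linear_extension_def
    using closed \<phi>g by (intro group_algebra_finsum_apply finite_carrier) auto
  also have "\<dots> = (\<Oplus>\<^bsub>F\<^esub>h\<in>carrier G. if g = h then a h else \<zero>\<^bsub>F\<^esub>)"
  proof (intro F.finsum_cong')
    fix h assume "h \<in> carrier G"
    then show "(a h \<odot>\<^bsub>A\<^esub> group_elem F G (\<phi> h)) (\<phi> g) = (if g = h then a h else \<zero>\<^bsub>F\<^esub>)"
      using a g \<phi>g bij
      by (auto simp: group_algebra_simps(5) group_elem_def bij_betw_def inj_on_eq_iff)
  qed (use a in auto)
  also have "\<dots> = a g"
    using g a finsum_delta[of "carrier G" a g] by auto
  finally show "linear_extension F G \<phi> a (\<phi> g) = a g" .
qed

lemma linear_extension_subgroup_s_ring:
  assumes phi: "\<phi> \<in> auto G" and H: "subgroup H G"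
  shows "linear_extension F G \<phi> ` subgroup_s_ring H = subgroup_s_ring (\<phi> ` H)"
proof -
  have bij: "bij_betw \<phi> (carrier G) (carrier G)" and hom: "\<phi> \<in> hom G G"
    using phi by (auto simp: auto_def Bij_def)
  have one: "\<phi> \<one>\<^bsub>G\<^esub> = \<one>\<^bsub>G\<^esub>"
    using hom by (simp add: hom_one G.group_axioms)
  have HG: "H \<subseteq> carrier G" "\<one>\<^bsub>G\<^esub> \<in> H"
    using subgroup.subset[OF H] subgroup.one_closed[OF H] by auto
  have inj: "inj_on \<phi> (carrier G)" and img: "\<phi> ` carrier G = carrier G"
    using bij by (auto simp: bij_betw_def)
  have blocks: "\<phi> ` H - {\<one>\<^bsub>G\<^esub>} = \<phi> ` (H - {\<one>\<^bsub>G\<^esub>})"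
    "carrier G - \<phi> ` H = \<phi> ` (carrier G - H)"
    using inj_on_image_set_diff[OF inj, of H "{\<one>\<^bsub>G\<^esub>}"]
      inj_on_image_set_diff[OF inj, of "carrier G" H] HG one img by auto
  have "linear_extension F G \<phi> a \<in> subgroup_s_ring (\<phi> ` H)" if a: "a \<in> subgroup_s_ring H" for a
  proof (rule subgroup_s_ringI)
    note aA = subgroup_s_ringD(1)[OF a]
    show "linear_extension F G \<phi> a \<in> carrier A"
      by (rule linear_extension_apply(1)[OF phi aA])
    show "linear_extension F G \<phi> a x = linear_extension F G \<phi> a y"
      if xy: "x \<in> \<phi> ` H - {\<one>\<^bsub>G\<^esub>}" "y \<in> \<phi> ` H - {\<one>\<^bsub>G\<^esub>}" for x y
    proof -
      obtain u v where uv: "u \<in> H - {\<one>\<^bsub>G\<^esub>}" "v \<in> H - {\<one>\<^bsub>G\<^esub>}" "x = \<phi> u" "y = \<phi> v"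
        using xy unfolding blocks by blast
      then show ?thesis
        using subgroup_s_ringD(2)[OF a uv(1,2)] linear_extension_apply(2)[OF phi aA] HG
        by (simp add: subset_iff)
    qed
    show "linear_extension F G \<phi> a x = linear_extension F G \<phi> a y"
      if xy: "x \<in> carrier G - \<phi> ` H" "y \<in> carrier G - \<phi> ` H" for x y
    proof -
      obtain u v where uv: "u \<in> carrier G - H" "v \<in> carrier G - H" "x = \<phi> u" "y = \<phi> v"
        using xy unfolding blocks by blast
      then show ?thesis
        using subgroup_s_ringD(3)[OF a uv(1,2)] linear_extension_apply(2)[OF phi aA]
        by simp
    qed
  qed
  moreover have "b \<in> linear_extension F G \<phi> ` subgroup_s_ring H"
    if b: "b \<in> subgroup_s_ring (\<phi> ` H)" for b
  proof
    \<comment> \<open>The preimage of \<open>b\<close> is its pullback along \<open>\<phi>\<close>,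
      restricted because elements of the group algebra are \<open>undefined\<close> off the
      carrier.\<close>
    let ?a = "\<lambda>x\<in>carrier G. b (\<phi> x)"
    have bA: "b \<in> carrier A"
      by (rule subgroup_s_ringD(1)[OF b])
    have \<phi>_closed: "\<phi> x \<in> carrier G" if "x \<in> carrier G" for x
      using that img by blast
    have aA: "?a \<in> carrier A"
      using bA \<phi>_closed by (auto simp: group_algebra_simps(1))
    show "?a \<in> subgroup_s_ring H"
    proof (rule subgroup_s_ringI[OF aA])
      show "?a x = ?a y" if xy: "x \<in> H - {\<one>\<^bsub>G\<^esub>}" "y \<in> H - {\<one>\<^bsub>G\<^esub>}" for x y
        using subgroup_s_ringD(2)[OF b, of "\<phi> x" "\<phi> y"] xy HG unfolding blocks by auto
      show "?a x = ?a y" if xy: "x \<in> carrier G - H" "y \<in> carrier G - H" for x y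
        using subgroup_s_ringD(3)[OF b, of "\<phi> x" "\<phi> y"] xy unfolding blocks by auto
    qed
    show "b = linear_extension F G \<phi> ?a"
    proof (rule group_algebra_eqI[OF bA linear_extension_apply(1)[OF phi aA]])
      fix x assume "x \<in> carrier G"
      then obtain y where "y \<in> carrier G" "x = \<phi> y"
        using img by blast
      then show "b x = linear_extension F G \<phi> ?a x"
        using linear_extension_apply(2)[OF phi aA] by simp
    qed
  qed
  ultimately show ?thesis by blast
qed

lemma distinct_cayley_isomorphic_s_rings:
  assumes phi: "\<phi> \<in> auto G" and H: "subgroup H G" and moved: "\<phi> ` H \<noteq> H"
  shows "\<exists>S1 S2. s_ring F G S1 \<and> s_ring F G S2 \<and> S1 \<noteq> S2 \<and> cayley_isomorphic F G S1 S2"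
proof -
  have bij: "bij_betw \<phi> (carrier G) (carrier G)" and hom: "\<phi> \<in> hom G G"
    using phi by (auto simp: auto_def Bij_def)
  interpret group_hom G G \<phi>
    using hom by unfold_locales
  have HG: "H \<subseteq> carrier G"
    using subgroup.subset[OF H] .
  have K: "subgroup (\<phi> ` H) G"
    using H by (rule subgroup_img_is_subgroup)
  \<comment> \<open>An automorphism fixes \<open>{1}\<close> and the whole group, so a subgroup that
    is moved is neither.\<close>
  have nontriv: "H \<noteq> {\<one>\<^bsub>G\<^esub>}" "H \<noteq> carrier G"
    using moved bij by (auto simp: bij_betw_def)
  have "\<phi> ` H \<noteq> carrier G"
    using nontriv(2) HG bij by (metis bij_betw_def inj_on_image_eq_iff order_refl)
  moreover have "\<phi> ` H \<noteq> {\<one>\<^bsub>G\<^esub>}"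
  proof
    assume "\<phi> ` H = {\<one>\<^bsub>G\<^esub>}"
    then have "\<phi> ` H = \<phi> ` {\<one>\<^bsub>G\<^esub>}" by simp
    then show False
      using nontriv(1) HG bij
      by (metis G.one_closed bij_betw_def empty_subsetI inj_on_image_eq_iff insert_subset)
  qed
  ultimately show ?thesis
    using subgroup_s_ring[OF H nontriv] subgroup_s_ring[OF K] subgroup_s_ring_inj[OF H K nontriv(2)]
      moved linear_extension_subgroup_s_ring[OF phi H] phi
    unfolding cayley_isomorphic_def by metis
qed

end

section \<open>Finite groups whose automorphisms fix all cyclic subgroups\<close>

context group
begin

text \<open>Members of \<open>auto G\<close> are \<open>undefined\<close> off the carrier, whence
  the restriction; finiteness upgrades injectivity to bijectivity.\<close>

lemma restrict_in_autoI:
  assumes fin: "finite (carrier G)"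
    and closed: "\<And>x. x \<in> carrier G \<Longrightarrow> \<phi> x \<in> carrier G"
    and hom: "\<And>x y. x \<in> carrier G \<Longrightarrow> y \<in> carrier G \<Longrightarrow> \<phi> (x \<otimes> y) = \<phi> x \<otimes> \<phi> y"
    and ker: "\<And>x. x \<in> carrier G \<Longrightarrow> \<phi> x = \<one> \<Longrightarrow> x = \<one>"
  shows "restrict \<phi> (carrier G) \<in> auto G"
proof -
  have "group_hom G G \<phi>"
    using closed hom by unfold_locales (auto simp: hom_def)
  then interpret h: group_hom G G \<phi> .
  have "inj_on \<phi> (carrier G)"
    unfolding h.inj_iff_trivial_ker using ker by (auto simp: kernel_def)
  then have "bij_betw \<phi> (carrier G) (carrier G)"
    using closed endo_inj_surj[OF fin, of \<phi>] by (auto simp: bij_betw_def image_subset_iff)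
  then show ?thesis
    using closed hom by (auto simp: auto_def Bij_def hom_def cong: bij_betw_cong)
qed

text \<open>This keeps exponents natural: in a finite group a cyclic subgroup is the set of natural
  powers of its generator. The truncated subtraction is harmless since \<open>ord x\<close> is at
  least 1.\<close>

lemma inv_eq_pow:
  assumes "finite (carrier G)" "x \<in> carrier G"
  shows "inv x = x [^] (ord x - 1)"
proof -
  have "x [^] (ord x - 1) \<otimes> x = x [^] (Suc (ord x - 1))"
    by simp
  also have "\<dots> = \<one>"
    using assms ord_ge_1[OF assms] by (metis Suc_diff_1 One_nat_def Suc_le_eq pow_ord_eq_1)
  finally show ?thesis
    using assms by (metis inv_equality nat_pow_closed)
qed

lemma subgroup_nat_pow_closed: "subgroup H G \<Longrightarrow> x \<in> H \<Longrightarrow> x [^] (n::nat) \<in> H"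
  by (induction n) (auto simp: subgroup.one_closed subgroup.m_closed)

text \<open>Bezout in the form \<open>a * u = b * v + 1\<close> stays within the naturals but needs
  \<open>a \<noteq> 0\<close>; for \<open>a = 0\<close> coprimality forces
  \<open>b = 1\<close>.\<close>

lemma coprime_pow_in_subgroup:
  fixes a b :: nat
  assumes M: "subgroup M G" and y: "y \<in> carrier G"
    and ab: "y [^] a \<in> M" "y [^] b \<in> M" "coprime a b"
  shows "y \<in> M"
proof (cases "a = 0")
  case True
  then show ?thesis using ab y by simp
next
  case False
  then obtain u v where uv: "a * u = b * v + 1"
    using bezout_nat[of a b] ab(3) by auto
  have "y [^] (a * u) \<in> M" "y [^] (b * v) \<in> M"
    using subgroup_nat_pow_closed[OF M ab(1), of u] subgroup_nat_pow_closed[OF M ab(2), of v] y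
    by (simp_all add: nat_pow_pow)
  then have "inv (y [^] (b * v)) \<otimes> (y [^] (b * v) \<otimes> y) \<in> M"
    using M unfolding uv by (simp add: subgroup.m_closed subgroup.m_inv_closed)
  then show ?thesis
    using y by (simp add: m_assoc[symmetric])
qed

lemma ord_mult_coprime:
  assumes xy: "x \<in> carrier G" "y \<in> carrier G" "x \<otimes> y = y \<otimes> x" and "coprime (ord x) (ord y)"
  shows "ord (x \<otimes> y) = ord x * ord y"
proof (rule dvd_antisym)
  show "ord (x \<otimes> y) dvd ord x * ord y"
    using xy by (intro ord_mul_divides) auto
  have *: "ord x dvd ord (x \<otimes> y)"
    if xy: "x \<in> carrier G" "y \<in> carrier G" "x \<otimes> y = y \<otimes> x" and "coprime (ord x) (ord y)" for x y
  proof -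
    have "\<one> = (x \<otimes> y) [^] (ord (x \<otimes> y) * ord y)"
      using xy by (simp flip: nat_pow_pow)
    also have "\<dots> = x [^] (ord (x \<otimes> y) * ord y) \<otimes> y [^] (ord (x \<otimes> y) * ord y)"
      using xy by (intro pow_mult_distrib) auto
    also have "y [^] (ord (x \<otimes> y) * ord y) = \<one>"
      using xy by (simp add: pow_eq_id)
    finally have "ord x dvd ord (x \<otimes> y) * ord y"
      using xy by (simp add: pow_eq_id[symmetric])
    then show ?thesis
      using that(4) by (simp add: coprime_dvd_mult_left_iff)
  qed
  show "ord x * ord y dvd ord (x \<otimes> y)"
    using *[of x y] *[of y x] assms by (intro divides_mult) (auto simp: coprime_commute)
qed

end

section \<open>The abelian case\<close>

context comm_group
begin

text \<open>Any element of maximal order will do. If a prime occurred to a higher power in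
  \<open>ord y\<close> than in \<open>ord g\<close>, trading the p-part of \<open>g\<close> for that
  of \<open>y\<close> would give a larger order.\<close>

lemma exists_elem_of_exponent_order:
  assumes fin: "finite (carrier G)"
  obtains g where "g \<in> carrier G" "\<And>y. y \<in> carrier G \<Longrightarrow> y [^] ord g = \<one>"
proof -
  have "\<forall>y. y \<in> carrier G \<longrightarrow> ord y < Suc (order G)"
    using ord_le_group_order[OF fin] by (auto simp: less_Suc_eq_le)
  then obtain g where g: "g \<in> carrier G" "\<And>y. y \<in> carrier G \<Longrightarrow> ord y \<le> ord g"
    using ex_has_greatest_nat[of "\<lambda>y. y \<in> carrier G" \<one> ord] by (metis one_closed)
  have "ord y dvd ord g" if y: "y \<in> carrier G" for y
  proof (rule ccontr)
    assume ndvd: "\<not> ord y dvd ord g"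
    have pos: "ord y > 0" "ord g > 0"
      using ord_ge_1[OF fin] y g by (auto simp: Suc_le_eq)
    obtain p where p: "Factorial_Ring.prime p" "multiplicity p (ord g) < multiplicity p (ord y)"
      using ndvd pos by (metis multiplicity_le_imp_dvd not_less neq0_conv)
    let ?a = "multiplicity p (ord y)" and ?b = "multiplicity p (ord g)"
    obtain n where n: "ord g = p ^ ?b * n" "\<not> p dvd n"
      using pos p by (metis multiplicity_decompose' not_prime_unit neq0_conv)
    obtain m where m: "ord y = p ^ ?a * m"
      using multiplicity_dvd[of p "ord y"] by (auto simp: dvd_def)
    have "ord (g [^] (p ^ ?b)) = n"
      using ord_pow[of g "p ^ ?b"] n g(1) p(1) by (metis dvd_triv_left nonzero_mult_div_cancel_left power_not_zero not_prime_0)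
    moreover have "ord (y [^] m) = p ^ ?a"
      using ord_pow[of y m] m y pos by (metis dvd_triv_right nonzero_mult_div_cancel_right mult_0_right neq0_conv)
    moreover have "coprime n p"
      using p(1) n(2) by (metis prime_imp_coprime coprime_commute)
    ultimately have "ord (g [^] (p ^ ?b) \<otimes> y [^] m) = n * p ^ ?a"
      using ord_mult_coprime[of "g [^] (p ^ ?b)" "y [^] m"] g(1) y n(2) p(1)
      by (simp add: m_comm)
    moreover have "n * p ^ ?a > ord g"
    proof -
      have "p ^ ?b < p ^ ?a"
        using p by (intro power_strict_increasing) (auto simp: prime_gt_Suc_0_nat)
      moreover have "n > 0" using n(2) by (auto intro: gr0I)
      ultimately show ?thesis by (subst n(1)) simp
    qed
    ultimately show False
      using g y by (metis m_closed nat_pow_closed not_less)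
  qed
  then show thesis
    using that g(1) by (simp add: pow_eq_id)
qed

text \<open>\<open>K\<close> is a subgroup maximal among those meeting <g> trivially. The inverse of
  a power of \<open>g\<close> is again a natural power, so the last conclusion says that
  \<open>K\<close> and \<open>g\<close> generate the group.\<close>

lemma exists_complement:
  assumes fin: "finite (carrier G)" and g: "g \<in> carrier G"
    and expo: "\<And>y. y \<in> carrier G \<Longrightarrow> y [^] ord g = \<one>"
  obtains K where "subgroup K G" "\<And>i::nat. g [^] i \<in> K \<Longrightarrow> g [^] i = \<one>"
    "\<And>x. x \<in> carrier G \<Longrightarrow> \<exists>e::nat. x \<otimes> g [^] e \<in> K"
proof -
  define \<K> where "\<K> = {K. subgroup K G \<and> (\<forall>i::nat. g [^] i \<in> K \<longrightarrow> g [^] i = \<one>)}"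
  have "\<K> \<subseteq> Pow (carrier G)"
    by (auto simp: \<K>_def dest: subgroup.subset)
  then have "finite \<K>"
    using fin by (meson finite_Pow_iff finite_subset)
  moreover have "{\<one>} \<in> \<K>"
    by (auto simp: \<K>_def triv_subgroup)
  ultimately obtain K where "K \<in> \<K>" and max: "\<And>L. L \<in> \<K> \<Longrightarrow> K \<subseteq> L \<Longrightarrow> K = L"
    using finite_has_maximal[of \<K>] by blast
  then have K: "subgroup K G" and triv: "\<And>i::nat. g [^] i \<in> K \<Longrightarrow> g [^] i = \<one>"
    by (auto simp: \<K>_def)
  have KG: "K \<subseteq> carrier G"
    using K by (rule subgroup.subset)
  \<comment> \<open>This is the product of \<open>K\<close> and <g>; maximality of \<open>K\<close>
    has to show that it is everything.\<close>
  define M where "M = {x \<in> carrier G. \<exists>e::nat. x \<otimes> g [^] e \<in> K}"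
  have "K \<subseteq> M"
  proof
    fix k assume "k \<in> K"
    then have "k \<in> carrier G" "k \<otimes> g [^] (0::nat) \<in> K" using KG by auto
    then show "k \<in> M" unfolding M_def by blast
  qed
  have M: "subgroup M G"
  proof (rule subgroupI)
    show "M \<noteq> {}"
      using \<open>K \<subseteq> M\<close> subgroup.one_closed[OF K] by auto
    show "inv x \<in> M" if x: "x \<in> M" for x
    proof -
      obtain e where e: "x \<otimes> g [^] (e::nat) \<in> K" "x \<in> carrier G"
        using x by (auto simp: M_def)
      then have "inv x \<otimes> inv (g [^] e) \<in> K"
        using subgroup.m_inv_closed[OF K e(1)] g by (simp add: inv_mult)
      moreover have "inv (g [^] e) = g [^] ((ord g - 1) * e)"
        using g inv_eq_pow[OF fin g] by (metis nat_pow_inv nat_pow_pow)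
      ultimately show ?thesis using e by (auto simp: M_def)
    qed
    show "x \<otimes> y \<in> M" if xy: "x \<in> M" "y \<in> M" for x y
    proof -
      obtain d e where e: "x \<otimes> g [^] (d::nat) \<in> K" "x \<in> carrier G" "y \<otimes> g [^] (e::nat) \<in> K" "y \<in> carrier G"
        using xy by (auto simp: M_def)
      have "(x \<otimes> g [^] d) \<otimes> (y \<otimes> g [^] e) = (x \<otimes> y) \<otimes> g [^] (d + e)"
        using e g by (simp add: m_ac nat_pow_mult[symmetric])
      then show ?thesis
        using subgroup.m_closed[OF K e(1,3)] e by (auto simp: M_def)
    qed
  qed (auto simp: M_def)
  have powM: "g [^] i \<in> M" for i :: nat
  proof -
    have "g [^] i \<otimes> g [^] ((ord g - 1) * i) = \<one>"
      using g inv_eq_pow[OF fin g] by (metis nat_pow_inv nat_pow_pow nat_pow_closed r_inv)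
    then show ?thesis
      using g subgroup.one_closed[OF K] unfolding M_def by (metis (mono_tags, lifting) mem_Collect_eq nat_pow_closed)
  qed
  have "carrier G \<subseteq> M"
  proof (rule ccontr)
    assume "\<not> carrier G \<subseteq> M"
    then obtain z where z: "z \<in> carrier G" "z \<notin> M" by blast
    have "ord z > 0 \<and> z [^] ord z \<in> M"
      using z M ord_ge_1[OF fin] by (auto simp: subgroup.one_closed Suc_le_eq)
    then have "\<exists>m::nat. (m > 0 \<and> z [^] m \<in> M) \<and> (\<forall>j. j > 0 \<and> z [^] j \<in> M \<longrightarrow> m \<le> j)"
      by (rule ex_has_least_nat[of "\<lambda>j::nat. j > 0 \<and> z [^] j \<in> M" "ord z" "\<lambda>j. j"])
    then obtain m where least: "((m::nat) > 0 \<and> z [^] m \<in> M) \<and> (\<forall>j. j > 0 \<and> z [^] j \<in> M \<longrightarrow> m \<le> j)"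
      by (rule exE)
    then have m: "m > 0" "z [^] m \<in> M" "\<And>j. j > 0 \<Longrightarrow> z [^] j \<in> M \<Longrightarrow> m \<le> j"
      by simp_all
    have "m \<noteq> 1" using m z by auto
    then obtain p where p: "Factorial_Ring.prime p" "p dvd m"
      using prime_factor_nat by blast
    then obtain j where j: "m = p * j" by (auto simp: dvd_def)
    then have j0: "0 < j" "j < m"
      using m(1) prime_gt_1_nat[OF p(1)] by auto
    \<comment> \<open>As \<open>m\<close> is the least positive exponent that brings
      \<open>z\<close> into \<open>M\<close>, the power \<open>z [^] (m / p)\<close> is still
      outside, while its p-th power is inside.\<close>
    define y where "y = z [^] j"
    have "z [^] j \<notin> M"
      using m(3)[OF j0(1)] j0(2) by (meson not_le)
    then have y: "y \<in> carrier G" "y \<notin> M" "y [^] p \<in> M"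
      using z m(2) j by (simp_all add: y_def nat_pow_pow mult.commute)
    have "p dvd ord g"
    proof (rule ccontr)
      assume "\<not> p dvd ord g"
      then have "coprime p (ord g)"
        using p(1) by (simp add: prime_imp_coprime)
      then show False
        using coprime_pow_in_subgroup[OF M y(1,3), of "ord g"] y(1,2) M
        by (simp add: expo subgroup.one_closed)
    qed
    then obtain n where n: "ord g = p * n" by (auto simp: dvd_def)
    then have "n > 0" using ord_ge_1[OF fin g] by (auto intro: gr0I)
    obtain a where a: "y [^] p \<otimes> g [^] (a::nat) \<in> K"
      using y(3) by (auto simp: M_def)
    \<comment> \<open>The exponent condition enters here: raising to \<open>n = ord g / p\<close>
      kills \<open>y\<close>, leaving a power of \<open>g\<close> in \<open>K\<close>. That power is
      trivial, so \<open>p\<close> divides \<open>a\<close>.\<close>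
    have "(y [^] p \<otimes> g [^] a) [^] n = y [^] ord g \<otimes> g [^] (a * n)"
      using y g n by (simp add: pow_mult_distrib m_comm nat_pow_pow)
    then have "g [^] (a * n) \<in> K"
      using subgroup_nat_pow_closed[OF K a, of n] y(1) g by (simp add: expo)
    then have "p * n dvd a * n"
      using triv g n pow_eq_id by metis
    then have "p dvd a" using \<open>n > 0\<close> by simp
    then obtain b where b: "a = p * b" by (auto simp: dvd_def)
    \<comment> \<open>Since \<open>a = p * b\<close>, correcting \<open>y\<close> by
      \<open>g [^] b\<close> moves its p-th power from \<open>M\<close> into \<open>K\<close>
      without moving the element itself into \<open>M\<close>.\<close>
    define w where "w = y \<otimes> g [^] b"
    have w: "w \<in> carrier G"
      using y g by (simp add: w_def)
    have wp: "w [^] p \<in> K"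
      using a y(1) g by (simp add: w_def b pow_mult_distrib m_comm nat_pow_pow mult.commute)
    have wM: "w \<notin> M"
    proof
      assume "w \<in> M"
      then have "w \<otimes> inv (g [^] b) \<in> M"
        using M powM[of b] by (simp add: subgroup.m_closed subgroup.m_inv_closed)
      then show False using y g by (simp add: w_def m_assoc)
    qed
    define L where "L = {k \<otimes> w [^] i | k i. k \<in> K \<and> i \<in> (UNIV :: nat set)}"
    have L: "subgroup L G"
    proof (rule subgroupI)
      show "L \<subseteq> carrier G" using KG w by (auto simp: L_def)
      show "L \<noteq> {}" using subgroup.one_closed[OF K] by (auto simp: L_def)
      show "inv x \<in> L" if x: "x \<in> L" for x
      proof -
        obtain k i where k: "x = k \<otimes> w [^] (i::nat)" "k \<in> K" using x by (auto simp: L_def)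
        then have "inv x = inv k \<otimes> w [^] ((ord w - 1) * i)"
          using KG w inv_eq_pow[OF fin w] by (metis inv_mult nat_pow_closed nat_pow_inv nat_pow_pow subsetD)
        then show ?thesis
          using subgroup.m_inv_closed[OF K k(2)] unfolding L_def by blast
      qed
      show "x \<otimes> x' \<in> L" if xx': "x \<in> L" "x' \<in> L" for x x'
      proof -
        obtain k i k' i' where k: "x = k \<otimes> w [^] (i::nat)" "k \<in> K" "x' = k' \<otimes> w [^] (i'::nat)" "k' \<in> K"
          using xx' by (auto simp: L_def)
        then have "k \<in> carrier G" "k' \<in> carrier G" using KG by auto
        then have "x \<otimes> x' = (k \<otimes> k') \<otimes> w [^] (i + i')"
          using k w by (simp add: m_ac nat_pow_mult[symmetric])
        then show ?thesis
          using subgroup.m_closed[OF K k(2,4)] unfolding L_def by blast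
      qed
    qed
    have "K \<subseteq> L"
    proof
      fix k assume k: "k \<in> K"
      then have "k = k \<otimes> w [^] (0::nat)" using KG by auto
      then show "k \<in> L" using k unfolding L_def by blast
    qed
    moreover have "w \<in> L"
    proof -
      have "w = \<one> \<otimes> w [^] (1::nat)" using w by simp
      then show ?thesis using subgroup.one_closed[OF K] unfolding L_def by blast
    qed
    ultimately have "L \<notin> \<K>"
      using max[of L] wM \<open>K \<subseteq> M\<close> by blast
    then obtain j where j: "g [^] (j::nat) \<in> L" "g [^] j \<noteq> \<one>"
      using L by (auto simp: \<K>_def)
    then obtain k i where k: "g [^] j = k \<otimes> w [^] (i::nat)" "k \<in> K"
      by (auto simp: L_def)
    \<comment> \<open>If \<open>p\<close> divides \<open>i\<close>, then \<open>w [^] i\<close> is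
      in \<open>K\<close> and so is the nontrivial \<open>g [^] j\<close>; otherwise
      \<open>w [^] i\<close> and \<open>w [^] p\<close> both lie in \<open>M\<close> with coprime
      exponents, which forces \<open>w\<close> into \<open>M\<close>.\<close>
    show False
    proof (cases "p dvd i")
      case True
      then obtain t where "i = p * t" by (auto simp: dvd_def)
      then have "w [^] i \<in> K"
        using subgroup_nat_pow_closed[OF K wp, of t] w by (simp add: nat_pow_pow)
      then have "g [^] j \<in> K" using k K by (simp add: subgroup.m_closed)
      then show False using triv j by blast
    next
      case False
      have "inv k \<otimes> g [^] j \<in> M"
        using M k(2) \<open>K \<subseteq> M\<close> powM[of j] by (auto intro: subgroup.m_closed subgroup.m_inv_closed)
      moreover have "inv k \<otimes> g [^] j = w [^] i"
        using k w KG by (auto simp: m_assoc[symmetric])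
      moreover have "coprime i p"
        using False p(1) by (metis prime_imp_coprime coprime_commute)
      ultimately show False
        using coprime_pow_in_subgroup[OF M w, of i p] wp wM \<open>K \<subseteq> M\<close> by auto
    qed
  qed
  then have "\<exists>e::nat. x \<otimes> g [^] e \<in> K" if "x \<in> carrier G" for x
    using that by (auto simp: M_def)
  then show thesis using that K triv by blast
qed

lemma cyclic_if_power_automorphisms:
  assumes fin: "finite (carrier G)"
    and power: "\<And>\<phi> x. \<phi> \<in> auto G \<Longrightarrow> x \<in> carrier G \<Longrightarrow> \<exists>n::nat. \<phi> x = x [^] n"
  shows "cyclic_group G"
proof -
  obtain g where g: "g \<in> carrier G" "\<And>y. y \<in> carrier G \<Longrightarrow> y [^] ord g = \<one>"
    using exists_elem_of_exponent_order[OF fin] by blast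
  obtain K where K: "subgroup K G" "\<And>i::nat. g [^] i \<in> K \<Longrightarrow> g [^] i = \<one>"
    "\<And>x. x \<in> carrier G \<Longrightarrow> \<exists>e::nat. x \<otimes> g [^] e \<in> K"
    using exists_complement[OF fin g] by blast
  have KG: "K \<subseteq> carrier G"
    using K(1) by (rule subgroup.subset)
  have ginv: "g [^] (ord g - 1) = inv g"
    using inv_eq_pow[OF fin g(1)] by simp
  have "K \<subseteq> {\<one>}"
  proof
    fix h assume hK: "h \<in> K"
    then have h: "h \<in> carrier G" using KG by blast
    \<comment> \<open>Writing \<open>x\<close> as \<open>k\<close> times the inverse of
      \<open>g [^] e x\<close> with \<open>k\<close> in \<open>K\<close>, the map
      \<open>\<phi>\<close> leaves \<open>k\<close> alone and multiplies \<open>g\<close> by the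
      inverse of \<open>h\<close>. The choice fixes \<open>e x\<close> only modulo
      \<open>ord g\<close>, which does not affect \<open>h [^] e x\<close> because
      \<open>h [^] ord g\<close> is trivial.\<close>
    define e where "e = (\<lambda>x. SOME e::nat. x \<otimes> g [^] e \<in> K)"
    define \<phi> where "\<phi> = (\<lambda>x. x \<otimes> h [^] e x)"
    have e: "x \<otimes> g [^] e x \<in> K" if "x \<in> carrier G" for x
      unfolding e_def using someI_ex[OF K(3)[OF that]] .
    have unique: "h [^] a = h [^] b"
      if x: "x \<in> carrier G" and ab: "x \<otimes> g [^] a \<in> K" "x \<otimes> g [^] b \<in> K" for x and a b :: nat
    proof -
      have *: "h [^] a = h [^] b" if le: "a \<le> b" and ab: "x \<otimes> g [^] a \<in> K" "x \<otimes> g [^] b \<in> K" for a b :: nat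
      proof -
        have "inv (x \<otimes> g [^] a) \<otimes> (x \<otimes> g [^] b) \<in> K"
          using ab K(1) by (simp add: subgroup.m_closed subgroup.m_inv_closed)
        moreover have "x \<otimes> g [^] b = (x \<otimes> g [^] a) \<otimes> g [^] (b - a)"
          using x g(1) le by (simp add: m_assoc nat_pow_mult)
        moreover have "inv (x \<otimes> g [^] a) \<otimes> ((x \<otimes> g [^] a) \<otimes> g [^] (b - a)) = g [^] (b - a)"
          using x g(1) by (subst m_assoc[symmetric]) auto
        ultimately have "g [^] (b - a) \<in> K"
          by simp
        then have "ord g dvd b - a"
          using K(2) g(1) pow_eq_id by blast
        then obtain t where "b - a = ord g * t" by (auto simp: dvd_def)
        then have "h [^] (b - a) = \<one>"
          using h g(2)[OF h] by (metis nat_pow_one nat_pow_pow)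
        then have "h [^] a \<otimes> h [^] (b - a) = h [^] a"
          using h by simp
        then show ?thesis
          using le h by (simp add: nat_pow_mult)
      qed
      show ?thesis
        using *[of a b] *[of b a] ab by (metis nat_le_linear)
    qed
    have "restrict \<phi> (carrier G) \<in> auto G"
    proof (rule restrict_in_autoI[OF fin])
      show "\<phi> x \<in> carrier G" if "x \<in> carrier G" for x
        using that h by (simp add: \<phi>_def)
      show "\<phi> (x \<otimes> y) = \<phi> x \<otimes> \<phi> y" if xy: "x \<in> carrier G" "y \<in> carrier G" for x y
      proof -
        have "(x \<otimes> g [^] e x) \<otimes> (y \<otimes> g [^] e y) = (x \<otimes> y) \<otimes> g [^] (e x + e y)"
          using xy g(1) by (simp add: m_ac nat_pow_mult[symmetric])
        then have "(x \<otimes> y) \<otimes> g [^] (e x + e y) \<in> K"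
          using subgroup.m_closed[OF K(1) e[OF xy(1)] e[OF xy(2)]] by simp
        then have "h [^] e (x \<otimes> y) = h [^] (e x + e y)"
          by (rule unique[OF m_closed[OF xy] e[OF m_closed[OF xy]]])
        then show ?thesis
          using xy h by (simp add: \<phi>_def m_ac nat_pow_mult[symmetric])
      qed
      show "x = \<one>" if x: "x \<in> carrier G" "\<phi> x = \<one>" for x
      proof -
        have "x = inv (h [^] e x)"
          using x h by (metis \<phi>_def inv_equality inv_inv nat_pow_closed)
        then have "x \<in> K"
          using subgroup_nat_pow_closed[OF K(1) hK, of "e x"] K(1) by (metis subgroup.m_inv_closed)
        \<comment> \<open>For an element of \<open>K\<close> the exponent 0 is admissible as
          well.\<close>
        then have "h [^] e x = h [^] (0::nat)"
          by (intro unique[OF x(1) e[OF x(1)]]) (simp add: x(1))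
        then show ?thesis using x by (simp add: \<phi>_def)
      qed
    qed
    \<comment> \<open>The exponent of \<open>g\<close> is -1 modulo \<open>ord g\<close>. If the
      image of \<open>g\<close> is a power of \<open>g\<close>, the inverse of \<open>h\<close> is
      one too, hence lies in the trivial intersection of \<open>K\<close> with <g>.\<close>
    then obtain n where "\<phi> g = g [^] (n::nat)"
      using power[of "restrict \<phi> (carrier G)" g] g(1) by auto
    moreover have "g \<otimes> g [^] (ord g - 1) \<in> K"
      unfolding ginv using g(1) subgroup.one_closed[OF K(1)] by simp
    then have "h [^] e g = h [^] (ord g - 1)"
      by (rule unique[OF g(1) e[OF g(1)]])
    ultimately have eq: "g \<otimes> h [^] (ord g - 1) = g [^] n"
      by (simp add: \<phi>_def)
    have "h [^] (ord g - 1) = inv g \<otimes> (g \<otimes> h [^] (ord g - 1))"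
      using g(1) h by (simp add: m_assoc[symmetric])
    also have "\<dots> = g [^] (ord g - 1 + n)"
      unfolding eq ginv[symmetric] using g(1) by (simp add: nat_pow_mult)
    finally have "h [^] (ord g - 1) = \<one>"
      using K(2)[of "ord g - 1 + n"] subgroup_nat_pow_closed[OF K(1) hK, of "ord g - 1"] by simp
    moreover have "h [^] Suc (ord g - 1) = \<one>"
      using g(2)[OF h] ord_ge_1[OF fin g(1)] by simp
    ultimately show "h \<in> {\<one>}" using h by simp
  qed
  have "x \<in> range (\<lambda>n::int. g [^] n)" if x: "x \<in> carrier G" for x
  proof -
    obtain e where "x \<otimes> g [^] (e::nat) = \<one>"
      using K(3)[OF x] \<open>K \<subseteq> {\<one>}\<close> by blast
    then have "x = inv (g [^] e)"
      using x g(1) by (metis inv_equality inv_inv nat_pow_closed)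
    then have "x = g [^] (- int e)"
      using g(1) by (simp add: int_pow_neg int_pow_int)
    then show ?thesis by blast
  qed
  then show ?thesis
    unfolding cyclic_group using g(1) by (intro bexI[of _ g]) auto
qed

end

section \<open>Prime powers and commutator calculus with central commutators\<close>

text \<open>Here \<open>k\<close> is a power of \<open>p\<close>, and in k(k-1)/2 the division by 2
  can cost the factor \<open>p\<close> only if \<open>p = 2\<close> and \<open>k = 2\<close>. This
  exception is what leaves room for elements of order 4 as in the quaternion group.\<close>

lemma prime_dvd_choose_two:
  assumes "Factorial_Ring.prime (p::nat)" and "p * k = p ^ n" and "\<not> (p = 2 \<and> k = 2)"
  shows "p dvd (k choose 2)"
proof (cases "k = 1")
  case False
  have "p > 1"
    using assms(1) by (rule prime_gt_1_nat)
  have "n \<noteq> 0"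
    using assms(2) \<open>p > 1\<close> by (cases n) auto
  then obtain m where k: "k = p ^ m"
    using assms(2) \<open>p > 1\<close> by (cases n) auto
  with False have "m \<noteq> 0" by (cases m) auto
  then obtain j where j: "k = p * p ^ j" "m = Suc j"
    using k by (cases m) auto
  have "even (k * (k - 1))" by (cases k) auto
  then have two: "2 * (k choose 2) = k * (k - 1)"
    by (simp only: choose_two dvd_mult_div_cancel)
  show ?thesis
  proof (cases "p = 2")
    case True
    then have "j \<noteq> 0" using assms(3) j(1) by (cases j) auto
    then obtain i where "j = Suc i" by (cases j) auto
    then have "k choose 2 = 2 * (2 ^ i * (k - 1))"
      using two True j(1) by simp
    then show ?thesis using True by simp
  next
    case False
    have "p dvd 2 * (k choose 2)"
      unfolding two using j(1) by simp
    moreover have "\<not> p dvd 2"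
      using False \<open>p > 1\<close> by (auto dest: dvd_imp_le)
    ultimately show ?thesis
      using assms(1) by (simp add: prime_dvd_mult_iff)
  qed
qed (simp add: binomial_eq_0)

lemma prime_power_of_unique_prime_divisor:
  fixes n :: nat
  assumes "n > 0" "\<And>q. Factorial_Ring.prime q \<Longrightarrow> q dvd n \<Longrightarrow> q = p"
  shows "\<exists>m. n = p ^ m"
  using assms
proof (induction n rule: less_induct)
  case (less n)
  show ?case
  proof (cases "n = 1")
    case True
    then show ?thesis by (intro exI[of _ 0]) simp
  next
    case False
    then obtain q where "Factorial_Ring.prime q" "q dvd n"
      using prime_factor_nat by blast
    moreover from this have "q = p" using less.prems(2) by blast
    ultimately obtain k where k: "n = p * k" "Factorial_Ring.prime p"
      by (auto simp: dvd_def)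
    then have "k < n" "k > 0" using less.prems(1) prime_gt_1_nat[of p] by auto
    then obtain m where "k = p ^ m"
      using less.IH[of k] less.prems(2) k(1) by auto
    then show ?thesis using k by (intro exI[of _ "Suc m"]) simp
  qed
qed

context group
begin

definition central :: "'a \<Rightarrow> bool" where
  "central c \<longleftrightarrow> c \<in> carrier G \<and> (\<forall>z\<in>carrier G. c \<otimes> z = z \<otimes> c)"

lemma centralD: "central c \<Longrightarrow> c \<in> carrier G" "central c \<Longrightarrow> z \<in> carrier G \<Longrightarrow> c \<otimes> z = z \<otimes> c"
  by (auto simp: central_def)

lemma central_lcomm:
  "central c \<Longrightarrow> x \<in> carrier G \<Longrightarrow> y \<in> carrier G \<Longrightarrow> x \<otimes> (c \<otimes> y) = c \<otimes> (x \<otimes> y)"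
  by (metis centralD m_assoc)

lemma central_pow: "central c \<Longrightarrow> central (c [^] (n::nat))"
  by (auto simp: central_def intro: pow_mult_distrib nat_pow_comm)
    (metis group_commutes_pow)

text \<open>The element \<open>c\<close> is the commutator of \<open>x\<close> and \<open>y\<close>;
  carrying \<open>y\<close> past each factor \<open>x\<close> releases one copy of it.\<close>

lemma commute_pow_central:
  assumes "x \<in> carrier G" "y \<in> carrier G" "central c" "x \<otimes> y = c \<otimes> (y \<otimes> x)"
  shows "x [^] (k::nat) \<otimes> y = c [^] k \<otimes> (y \<otimes> x [^] k)"
proof (induction k)
  case (Suc k)
  note [simp] = centralD(1)[OF assms(3)] centralD(1)[OF central_pow[OF assms(3)]]
  have "x [^] Suc k \<otimes> y = x [^] k \<otimes> (c \<otimes> (y \<otimes> x))"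
    using assms by (simp add: m_assoc)
  also have "\<dots> = c \<otimes> ((x [^] k \<otimes> y) \<otimes> x)"
    using assms by (simp add: m_assoc central_lcomm)
  also have "\<dots> = c [^] Suc k \<otimes> (y \<otimes> x [^] Suc k)"
    using assms by (simp add: Suc m_assoc central_lcomm)
  finally show ?case .
qed (use assms in auto)

lemma commute_pow_central':
  assumes "x \<in> carrier G" "y \<in> carrier G" "central c" "y \<otimes> x = c \<otimes> (x \<otimes> y)"
  shows "y \<otimes> x [^] (k::nat) = c [^] k \<otimes> (x [^] k \<otimes> y)"
proof (induction k)
  case (Suc k)
  note [simp] = centralD(1)[OF assms(3)] centralD(1)[OF central_pow[OF assms(3)]]
  have "y \<otimes> x [^] Suc k = (y \<otimes> x [^] k) \<otimes> x"
    using assms by (simp add: m_assoc)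
  also have "\<dots> = c [^] k \<otimes> (x [^] k \<otimes> (y \<otimes> x))"
    using assms by (simp add: Suc m_assoc)
  also have "\<dots> = c [^] Suc k \<otimes> (x [^] Suc k \<otimes> y)"
    using assms by (simp add: assms(4) m_assoc central_lcomm)
  finally show ?case .
qed (use assms in auto)

text \<open>Collecting the next \<open>x\<close> to the left past \<open>y [^] k\<close> costs
  \<open>c [^] k\<close>, and 0 + 1 + ... + (k-1) is the binomial coefficient.\<close>

lemma pow_mult_central:
  assumes "x \<in> carrier G" "y \<in> carrier G" "central c" "y \<otimes> x = c \<otimes> (x \<otimes> y)"
  shows "(x \<otimes> y) [^] (k::nat) = c [^] (k choose 2) \<otimes> (x [^] k \<otimes> y [^] k)"
proof (induction k)
  case (Suc k)
  note [simp] = centralD(1)[OF assms(3)] centralD(1)[OF central_pow[OF assms(3)]]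
  have "(x \<otimes> y) [^] Suc k = c [^] (k choose 2) \<otimes> (x [^] k \<otimes> ((y [^] k \<otimes> x) \<otimes> y))"
    using assms by (simp add: Suc m_assoc)
  also have "y [^] k \<otimes> x = c [^] k \<otimes> (x \<otimes> y [^] k)"
    using assms by (intro commute_pow_central)
  also have "c [^] (k choose 2) \<otimes> (x [^] k \<otimes> ((c [^] k \<otimes> (x \<otimes> y [^] k)) \<otimes> y))
      = (c [^] (k choose 2) \<otimes> c [^] k) \<otimes> (x [^] Suc k \<otimes> y [^] Suc k)"
    using assms by (simp add: m_assoc central_lcomm central_pow)
  also have "c [^] (k choose 2) \<otimes> c [^] k = c [^] (Suc k choose 2)"
    by (simp add: nat_pow_mult numeral_2_eq_2 add.commute)
  finally show ?case .
qed (use assms in \<open>auto simp: binomial_eq_0\<close>)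

text \<open>In a group of prime order every nontrivial element is a generator.\<close>

lemma pow_of_pow_of_prime_order:
  assumes v: "v \<in> carrier G" "v [^] (p::nat) = \<one>" and p: "Factorial_Ring.prime p"
    and r: "v [^] (r::nat) \<noteq> \<one>"
  shows "\<exists>s::nat. (v [^] r) [^] s = v"
proof -
  have "\<not> p dvd r"
    using r v by (metis dvd_def nat_pow_one nat_pow_pow)
  then have "coprime r p"
    using p by (metis prime_imp_coprime coprime_commute)
  moreover have "r \<noteq> 0" using r by (intro notI) simp
  ultimately obtain s t where st: "r * s = p * t + 1"
    using bezout_nat[of r p] by auto
  have "(v [^] r) [^] s = (v [^] p) [^] t \<otimes> v"
    using v(1) by (simp add: nat_pow_pow st)
  then show ?thesis using v by auto
qed

text \<open>In a cyclic group of order \<open>p * k\<close> the elements killed by \<open>p\<close>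
  are those whose exponent is a multiple of \<open>k\<close>.\<close>

lemma pow_of_prime_index:
  assumes u: "u \<in> carrier G" "ord u = p * k" and c: "c = u [^] (i::nat)" "c [^] p = \<one>" and "p > 0"
  shows "\<exists>r::nat. c = (u [^] k) [^] r"
proof -
  have "p * k dvd i * p"
    using c u by (metis nat_pow_pow pow_eq_id)
  then have "k dvd i" using \<open>p > 0\<close> by simp
  then show ?thesis using c(1) u(1) by (auto simp: dvd_def nat_pow_pow)
qed

end

section \<open>The nonabelian case: groups with all subgroups normal\<close>

text \<open>\<open>conj_pow\<close> makes every cyclic subgroup normal, and with them every
  subgroup.\<close>

locale finite_dedekind_group = group +
  assumes fin: "finite (carrier G)"
    and conj_pow: "x \<in> carrier G \<Longrightarrow> y \<in> carrier G \<Longrightarrow> \<exists>n::nat. y \<otimes> x \<otimes> inv y = x [^] n"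
begin

text \<open>Conjugation by \<open>x\<close> and by \<open>y\<close> raises a given \<open>w\<close>
  to powers \<open>i\<close> and \<open>j\<close>, and \<open>i * j = j * i\<close>. So
  \<open>x \<otimes> y\<close> and \<open>y \<otimes> x\<close> conjugate alike, and their quotient
  centralises everything.\<close>

lemma commutator_central:
  assumes x: "x \<in> carrier G" and y: "y \<in> carrier G"
  shows "central (x \<otimes> y \<otimes> inv (y \<otimes> x))"
proof -
  have conj: "(x \<otimes> y) \<otimes> w \<otimes> inv (x \<otimes> y) = (y \<otimes> x) \<otimes> w \<otimes> inv (y \<otimes> x)" if w: "w \<in> carrier G" for w
  proof -
    obtain i j where ij: "x \<otimes> w \<otimes> inv x = w [^] (i::nat)" "y \<otimes> w \<otimes> inv y = w [^] (j::nat)"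
      using conj_pow w x y by metis
    have conj_nat_pow: "g \<otimes> w [^] (n::nat) \<otimes> inv g = (g \<otimes> w \<otimes> inv g) [^] n" if "g \<in> carrier G" for g n
    proof (induction n)
      case (Suc n)
      have "(g \<otimes> w \<otimes> inv g) [^] Suc n = (g \<otimes> w [^] n \<otimes> inv g) \<otimes> (g \<otimes> w \<otimes> inv g)"
        by (simp add: Suc)
      also have "\<dots> = g \<otimes> w [^] n \<otimes> (inv g \<otimes> g) \<otimes> w \<otimes> inv g"
        using that w by (simp only: m_assoc m_closed inv_closed nat_pow_closed)
      also have "\<dots> = g \<otimes> w [^] Suc n \<otimes> inv g"
        using that w by (simp add: m_assoc)
      finally show ?case by simp
    qed (use that in auto)
    have "(x \<otimes> y) \<otimes> w \<otimes> inv (x \<otimes> y) = x \<otimes> (y \<otimes> w \<otimes> inv y) \<otimes> inv x"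
      using w x y by (simp add: m_assoc inv_mult_group)
    also have "\<dots> = w [^] (i * j)"
      using w x y by (simp add: ij conj_nat_pow nat_pow_pow)
    also have "\<dots> = y \<otimes> (x \<otimes> w \<otimes> inv x) \<otimes> inv y"
      using w x y by (simp add: ij conj_nat_pow nat_pow_pow mult.commute)
    also have "\<dots> = (y \<otimes> x) \<otimes> w \<otimes> inv (y \<otimes> x)"
      using w x y by (simp add: m_assoc inv_mult_group)
    finally show ?thesis .
  qed
  let ?u = "x \<otimes> y" and ?v = "y \<otimes> x"
  have uv: "?u \<in> carrier G" "?v \<in> carrier G" using x y by auto
  have "(?u \<otimes> inv ?v) \<otimes> w = w \<otimes> (?u \<otimes> inv ?v)" if w: "w \<in> carrier G" for w
  proof -
    \<comment> \<open>Chosen so that conjugating it by \<open>?v\<close> returns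
      \<open>w\<close>.\<close>
    let ?w = "inv ?v \<otimes> w \<otimes> ?v"
    have "?u \<otimes> ?w \<otimes> inv ?u = ?v \<otimes> ?w \<otimes> inv ?v"
      using conj[of ?w] w uv by simp
    also have "\<dots> = (?v \<otimes> inv ?v) \<otimes> w \<otimes> (?v \<otimes> inv ?v)"
      using w uv by (simp only: m_assoc m_closed inv_closed)
    also have "\<dots> = w"
      using w uv by simp
    finally have "?u \<otimes> ?w \<otimes> inv ?u \<otimes> (?u \<otimes> inv ?v) = w \<otimes> (?u \<otimes> inv ?v)" by simp
    moreover have "?u \<otimes> ?w \<otimes> inv ?u \<otimes> (?u \<otimes> inv ?v) = (?u \<otimes> inv ?v) \<otimes> w \<otimes> ?v \<otimes> (inv ?u \<otimes> ?u) \<otimes> inv ?v"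
      using w uv by (simp only: m_assoc m_closed inv_closed)
    moreover have "\<dots> = (?u \<otimes> inv ?v) \<otimes> w \<otimes> (?v \<otimes> inv ?v)"
      using w uv by (simp add: m_assoc del: r_inv)
    ultimately show ?thesis
      using w uv by simp
  qed
  then show ?thesis
    using uv by (simp add: central_def)
qed

text \<open>Bracketed as x (y x^-1 y^-1) the commutator is a power of \<open>x\<close>, bracketed as
  (x y x^-1) y^-1 a power of \<open>y\<close>.\<close>

lemma commutator_cases:
  assumes x: "x \<in> carrier G" and y: "y \<in> carrier G"
  obtains c i j where "central c" "x \<otimes> y = c \<otimes> (y \<otimes> x)" "c = x [^] (i::nat)" "c = y [^] (j::nat)"
proof -
  let ?c = "x \<otimes> y \<otimes> inv (y \<otimes> x)"
  have "x \<otimes> y = ?c \<otimes> (y \<otimes> x)"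
    using x y by (simp add: m_assoc)
  moreover have "\<exists>i::nat. ?c = x [^] i"
  proof -
    obtain n where n: "y \<otimes> inv x \<otimes> inv y = inv x [^] (n::nat)"
      using conj_pow[of "inv x" y] x y by auto
    have "?c = x \<otimes> (y \<otimes> inv x \<otimes> inv y)"
      using x y by (simp add: inv_mult_group m_assoc)
    also have "\<dots> = x \<otimes> x [^] ((ord x - 1) * n)"
      unfolding n using x by (simp add: inv_eq_pow[OF fin x] nat_pow_pow)
    also have "\<dots> = x [^] Suc ((ord x - 1) * n)"
      using x by (rule nat_pow_Suc2[symmetric])
    finally show ?thesis ..
  qed
  moreover have "\<exists>j::nat. ?c = y [^] j"
  proof -
    obtain n where n: "x \<otimes> y \<otimes> inv x = y [^] (n::nat)"
      using conj_pow[of y x] x y by auto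
    have "?c = (x \<otimes> y \<otimes> inv x) \<otimes> inv y"
      using x y by (simp add: inv_mult_group m_assoc)
    also have "\<dots> = y [^] (n + (ord y - 1))"
      unfolding n using y by (simp add: inv_eq_pow[OF fin y] nat_pow_mult)
    finally show ?thesis ..
  qed
  ultimately show thesis
    using that commutator_central[OF x y] by metis
qed

text \<open>
  An element \<open>y\<close> of minimal order outside the centre has order 4 and is centralised or inverted by
  every element: otherwise some power \<open>z\<close> of a noncommuting \<open>x\<close> yields a noncentral \<open>z \<otimes> y\<close> of
  smaller order.
\<close>

lemma exists_inverted_element:
  assumes nonab: "x0 \<in> carrier G" "y0 \<in> carrier G" "x0 \<otimes> y0 \<noteq> y0 \<otimes> x0"
  shows "\<exists>x\<in>carrier G. \<exists>y\<in>carrier G. x \<otimes> y \<noteq> y \<otimes> x \<and>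
    (\<forall>g\<in>carrier G. g \<otimes> y = y \<otimes> g \<or> g \<otimes> y = inv y \<otimes> g)"
proof -
  define P where "P = (\<lambda>y. y \<in> carrier G \<and> \<not> central y)"
  have "P y0" using nonab unfolding P_def central_def by metis
  then obtain y where y: "P y" and ymin: "\<And>z. P z \<Longrightarrow> ord y \<le> ord z"
    using ex_has_least_nat[of P y0 ord] by blast
  then have yG: "y \<in> carrier G" by (simp add: P_def)
  \<comment> \<open>A second minimal choice: among the elements not commuting with \<open>y\<close>,
    take \<open>x\<close> of least order. For primes q dividing the respective orders,
    \<open>y [^] q\<close> is then central and \<open>x [^] q\<close> commutes with
    \<open>y\<close>.\<close>
  define Q where "Q = (\<lambda>x. x \<in> carrier G \<and> x \<otimes> y \<noteq> y \<otimes> x)"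
  obtain x1 where "Q x1" using y unfolding P_def Q_def central_def by metis
  then obtain x where x: "Q x" and xmin: "\<And>z. Q z \<Longrightarrow> ord x \<le> ord z"
    using ex_has_least_nat[of Q x1 ord] by blast
  then have xG: "x \<in> carrier G" by (simp add: Q_def)
  have "P x" using x yG by (auto simp: P_def Q_def central_def)
  obtain c i j where c: "central c" "y \<otimes> x = c \<otimes> (x \<otimes> y)" "c = y [^] (i::nat)" "c = x [^] (j::nat)"
    using commutator_cases[OF yG xG] .
  have cG: "c \<in> carrier G" using c(1) by (rule centralD)
  have c1: "c \<noteq> \<one>" using c(2) x xG yG by (auto simp: Q_def)
  have ord_pow_less: "ord (u [^] q) < ord u"
    if "u \<in> carrier G" "Factorial_Ring.prime q" "q dvd ord u" for u q
    using that ord_pow[of u q] ord_ge_1[OF fin that(1)] prime_gt_Suc_0_nat[OF that(2)] by simp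
  \<comment> \<open>The commutator with \<open>z\<close> is multiplicative in \<open>y\<close>, so
    \<open>d [^] q\<close> is the commutator of the central element \<open>y [^] q\<close>.\<close>
  have killed: "d [^] q = \<one>"
    if z: "z \<in> carrier G" "central d" "y \<otimes> z = d \<otimes> (z \<otimes> y)"
      and q: "Factorial_Ring.prime q" "q dvd ord y" for z d q
  proof -
    have yq: "central (y [^] q)"
      using ord_pow_less[OF yG q] ymin[of "y [^] q"] yG by (auto simp: P_def)
    have "d [^] q \<otimes> (z \<otimes> y [^] q) = z \<otimes> y [^] q"
      using commute_pow_central[OF yG z, of q] centralD(2)[OF yq z(1)] by simp
    then show ?thesis
      using centralD(1)[OF z(2)] z(1) yG by simp
  qed
  have "y \<noteq> \<one>" using x xG by (auto simp: Q_def)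
  then have "ord y \<noteq> 1" using ord_eq_1[OF yG] by simp
  then obtain p where p: "Factorial_Ring.prime p" "p dvd ord y"
    using prime_factor_nat by blast
  have cp: "c [^] p = \<one>"
    using killed[OF xG c(1,2) p] .
  \<comment> \<open>The nontrivial \<open>c\<close> has order \<open>p\<close>. Every prime dividing
    \<open>ord x\<close> or \<open>ord y\<close> kills \<open>c\<close>, so both orders are powers
    of \<open>p\<close>.\<close>
  have unique_prime: "q = p" if q: "Factorial_Ring.prime q" "c [^] q = \<one>" for q
  proof -
    have "ord c dvd p" "ord c dvd q" "ord c \<noteq> 1"
      using cp q(2) c1 cG pow_eq_id ord_eq_1 by blast+
    then show ?thesis using p(1) q(1) by (metis prime_nat_iff)
  qed
  have kill_x: "c [^] q = \<one>" if q: "Factorial_Ring.prime q" "q dvd ord x" for q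
  proof -
    have "x [^] q \<otimes> y = y \<otimes> x [^] q"
      using ord_pow_less[OF xG q] xmin[of "x [^] q"] xG by (auto simp: Q_def)
    then have "c [^] q \<otimes> (x [^] q \<otimes> y) = x [^] q \<otimes> y"
      using commute_pow_central'[OF xG yG c(1,2), of q] by simp
    then show ?thesis using cG xG yG by simp
  qed
  have "x \<noteq> \<one>" using x yG by (auto simp: Q_def)
  then have "ord x \<noteq> 1" using ord_eq_1[OF xG] by simp
  then have "p dvd ord x"
    using prime_factor_nat unique_prime kill_x by metis
  then obtain k k' where k: "ord y = p * k" "ord x = p * k'"
    using p(2) by (auto simp: dvd_def)
  have pos: "ord y > 0" "ord x > 0"
    using ord_ge_1[OF fin] xG yG by (auto simp: Suc_le_eq)
  then have kpos: "k > 0" "k' > 0" using k by (auto intro: gr0I)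
  have p1: "p > 1" using p(1) by (simp add: prime_gt_Suc_0_nat)
  obtain m where m: "ord y = p ^ m"
    using prime_power_of_unique_prime_divisor[OF pos(1), of p] unique_prime killed[OF xG c(1,2)] by blast
  obtain m' where m': "ord x = p ^ m'"
    using prime_power_of_unique_prime_divisor[OF pos(2), of p] unique_prime kill_x by blast
  have "ord y \<le> ord x" using ymin \<open>P x\<close> by blast
  then have "m \<le> m'" unfolding m m' using p1 by simp
  then have "p * k dvd p * k'" using k m m' by (metis le_imp_power_dvd)
  then obtain t where t: "k' = k * t" using p1 by (auto simp: dvd_def)
  obtain r where r: "c = (y [^] k) [^] (r::nat)"
    using pow_of_prime_index[OF yG k(1) c(3) cp] p1 by auto
  obtain r' where r': "c = (x [^] k') [^] (r'::nat)"
    using pow_of_prime_index[OF xG k(2) c(4) cp] p1 by auto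
  have ykp: "(y [^] k) [^] p = \<one>"
    using pow_ord_eq_1[OF yG] yG k(1) by (simp add: nat_pow_pow mult.commute)
  obtain s where s: "c [^] (s::nat) = y [^] k"
    using pow_of_pow_of_prime_order[OF _ ykp p(1), of r] r c1 yG by auto
  have "p = 2 \<and> k = 2"
  proof (rule ccontr)
    assume not2: "\<not> (p = 2 \<and> k = 2)"
    \<comment> \<open>The commutator \<open>c\<close> is a power of both \<open>y [^] k\<close> and
      \<open>x [^] k'\<close>, and it generates \<open>y [^] k\<close>, so \<open>y [^] k\<close> is
      the power of \<open>x\<close> with exponent \<open>k' * r' * s\<close>. Substituting
      \<open>k' = k * t\<close> and inverting by the factor \<open>ord (y [^] k) - 1\<close> yields
      \<open>z [^] k\<close> as the inverse of \<open>y [^] k\<close>.\<close>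
    define z where "z = x [^] (t * r' * s * (ord (y [^] k) - 1))"
    have zG: "z \<in> carrier G" using xG by (simp add: z_def)
    have "inv (y [^] k) = (((x [^] k') [^] r') [^] s) [^] (ord (y [^] k) - 1)"
      using inv_eq_pow[OF fin, of "y [^] k"] yG s r' by simp
    also have "\<dots> = z [^] k"
      using xG by (simp add: z_def t nat_pow_pow mult_ac)
    finally have zk: "z [^] k \<otimes> y [^] k = \<one>"
      using yG by (metis l_inv nat_pow_closed)
    obtain d i' j' where d: "central d" "y \<otimes> z = d \<otimes> (z \<otimes> y)" "d = y [^] (i'::nat)" "d = z [^] (j'::nat)"
      using commutator_cases[OF yG zG] .
    have dG: "d \<in> carrier G" using d(1) by (rule centralD)
    have "p dvd (k choose 2)"
      using prime_dvd_choose_two[OF p(1) _ not2] k(1) m by metis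
    then have "d [^] (k choose 2) = \<one>"
      using killed[OF zG d(1,2) p] dG by (metis dvd_def nat_pow_one nat_pow_pow)
    \<comment> \<open>The collection formula loses its commutator factor. The order of
      \<open>z \<otimes> y\<close> thus falls below the minimum, so this element is central; as
      \<open>z\<close> is a power of \<open>x\<close>, it would follow that \<open>x\<close>
      commutes with \<open>y\<close>.\<close>
    then have "(z \<otimes> y) [^] k = \<one>"
      using pow_mult_central[OF zG yG d(1,2), of k] zk by simp
    then have "ord (z \<otimes> y) dvd k"
      using zG yG by (simp add: pow_eq_id)
    then have "ord (z \<otimes> y) \<le> k" using kpos by (simp add: dvd_imp_le)
    also have "\<dots> < ord y" using k(1) kpos p1 by simp
    finally have "central (z \<otimes> y)"
      using ymin[of "z \<otimes> y"] zG yG by (auto simp: P_def)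
    then have "z \<otimes> y \<otimes> x = x \<otimes> (z \<otimes> y)"
      using xG by (rule centralD(2))
    also have "\<dots> = z \<otimes> x \<otimes> y"
      using xG yG zG group_commutes_pow[of x x] by (simp add: z_def m_assoc[symmetric])
    finally have "y \<otimes> x = x \<otimes> y"
      using xG yG zG by (simp add: m_assoc)
    then show False using x by (simp add: Q_def)
  qed
  then have y4: "ord y = 2 * 2" "p = 2" using k(1) by auto
  have "g \<otimes> y = y \<otimes> g \<or> g \<otimes> y = inv y \<otimes> g" if g: "g \<in> carrier G" for g
  proof -
    obtain d i' j' where d: "central d" "y \<otimes> g = d \<otimes> (g \<otimes> y)" "d = y [^] (i'::nat)" "d = g [^] (j'::nat)"
      using commutator_cases[OF yG g] .
    have "d [^] (2::nat) = \<one>"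
      using killed[OF g d(1,2) p] y4 by simp
    \<comment> \<open>As a power of \<open>y\<close> with trivial square, \<open>d\<close> is 1 or
      \<open>y [^] 2\<close>, according to the parity of \<open>n\<close>.\<close>
    then obtain n where n: "d = (y [^] (2::nat)) [^] (n::nat)"
      using pow_of_prime_index[OF yG y4(1) d(3)] by auto
    have y22: "(y [^] (2::nat)) [^] (2::nat) = \<one>"
      using yG y4(1) pow_ord_eq_1[OF yG] by (simp add: nat_pow_pow)
    show ?thesis
    proof (cases "even n")
      case True
      then obtain a where "n = 2 * a" by (auto simp: dvd_def)
      then have "d = ((y [^] (2::nat)) [^] (2::nat)) [^] a"
        using n yG by (simp add: nat_pow_pow)
      then have "d = \<one>" by (simp add: y22)
      then show ?thesis using d(2) g yG by simp
    next
      case False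
      then obtain a where "n = 2 * a + 1" by (auto elim: oddE)
      then have "d = ((y [^] (2::nat)) [^] (2::nat)) [^] a \<otimes> y [^] (2::nat)"
        using n yG by (simp add: nat_pow_pow nat_pow_mult)
      then have "d = y [^] (2::nat)"
        unfolding y22 using yG by simp
      then have "d = y \<otimes> y" using yG by (simp add: numeral_2_eq_2)
      then have "inv y \<otimes> (y \<otimes> g) = inv y \<otimes> (y \<otimes> (y \<otimes> (g \<otimes> y)))"
        using d(2) g yG by (simp add: m_assoc)
      then have "g = y \<otimes> (g \<otimes> y)"
        using g yG by (simp add: m_assoc[symmetric])
      then have "inv y \<otimes> g = inv y \<otimes> (y \<otimes> (g \<otimes> y))" by simp
      then show ?thesis
        using g yG by (simp add: m_assoc[symmetric])
    qed
  qed
  then show ?thesis using xG yG x unfolding Q_def by blast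
qed

end

section \<open>The outer automorphism and the conclusion for groups\<close>

context group
begin

lemma restrict_conj_in_auto:
  assumes "finite (carrier G)" and y: "y \<in> carrier G"
  shows "(\<lambda>x\<in>carrier G. y \<otimes> x \<otimes> inv y) \<in> auto G"
proof (rule restrict_in_autoI)
  show "y \<otimes> (a \<otimes> b) \<otimes> inv y = y \<otimes> a \<otimes> inv y \<otimes> (y \<otimes> b \<otimes> inv y)"
    if ab: "a \<in> carrier G" "b \<in> carrier G" for a b
  proof -
    have "y \<otimes> a \<otimes> inv y \<otimes> (y \<otimes> b \<otimes> inv y) = y \<otimes> a \<otimes> (inv y \<otimes> y) \<otimes> b \<otimes> inv y"
      using ab y by (simp only: m_assoc m_closed inv_closed)
    then show ?thesis using ab y by (simp add: m_assoc)
  qed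
  show "a = \<one>" if a: "a \<in> carrier G" "y \<otimes> a \<otimes> inv y = \<one>" for a
  proof -
    have "y \<otimes> a = y" using a y by (metis inv_equality inv_inv inv_closed m_closed)
    then show ?thesis using a y by simp
  qed
qed (use assms in auto)

text \<open>The decisive case is that of two factors outside the centraliser of \<open>y\<close>: in
  (g y)(h y) = g y y^-1 h the two copies of \<open>y\<close> cancel, while
  \<open>g \<otimes> h\<close> is back in the centraliser and stays fixed. A single factor outside
  can release its \<open>y\<close> to the right end.\<close>

lemma twist_in_auto:
  assumes fin: "finite (carrier G)" and y: "y \<in> carrier G"
    and inverts: "\<And>g. g \<in> carrier G \<Longrightarrow> g \<otimes> y = y \<otimes> g \<or> g \<otimes> y = inv y \<otimes> g"
  shows "(\<lambda>g\<in>carrier G. if g \<otimes> y = y \<otimes> g then g else g \<otimes> y) \<in> auto G"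
proof (rule restrict_in_autoI[OF fin])
  let ?\<phi> = "\<lambda>g. if g \<otimes> y = y \<otimes> g then g else g \<otimes> y"
  show "?\<phi> g \<in> carrier G" if "g \<in> carrier G" for g
    using that y by simp
  show "g = \<one>" if g: "g \<in> carrier G" "?\<phi> g = \<one>" for g
  proof (cases "g \<otimes> y = y \<otimes> g")
    case False
    \<comment> \<open>A nontrivial kernel element would have to be the inverse of \<open>y\<close>,
      which commutes with \<open>y\<close> and so is not in this case.\<close>
    then have "g = inv y" using g y by (metis inv_equality inv_inv)
    with False y show ?thesis by simp
  qed (use g in simp)
  fix g h assume gh: "g \<in> carrier G" "h \<in> carrier G"
  show "?\<phi> (g \<otimes> h) = ?\<phi> g \<otimes> ?\<phi> h"
  proof (cases "g \<otimes> y = y \<otimes> g")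
    case g: True
    have "g \<otimes> h \<otimes> y = y \<otimes> (g \<otimes> h) \<longleftrightarrow> h \<otimes> y = y \<otimes> h"
    proof -
      have "y \<otimes> (g \<otimes> h) = g \<otimes> (y \<otimes> h)"
        using g gh y by (metis m_assoc)
      then show ?thesis using gh y by (simp add: m_assoc)
    qed
    then show ?thesis using g gh y by (simp add: m_assoc)
  next
    case g: False
    then have gy: "g \<otimes> y = inv y \<otimes> g" using inverts gh by blast
    then have yg: "y \<otimes> (g \<otimes> y) = g"
      using gh y by (simp add: m_assoc[symmetric])
    show ?thesis
    proof (cases "h \<otimes> y = y \<otimes> h")
      case h: True
      have "g \<otimes> h \<otimes> y = (g \<otimes> y) \<otimes> h"
        using h gh y by (simp add: m_assoc)
      then show ?thesis
        using g h gh y by (auto simp: m_assoc[symmetric])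
    next
      case h: False
      then have hy: "h \<otimes> y = inv y \<otimes> h" using inverts gh by blast
      have prod: "(g \<otimes> y) \<otimes> (h \<otimes> y) = g \<otimes> h"
      proof -
        have "(g \<otimes> y) \<otimes> (h \<otimes> y) = g \<otimes> ((y \<otimes> inv y) \<otimes> h)"
          unfolding hy using gh y by (simp only: m_assoc m_closed inv_closed)
        then show ?thesis using gh y by simp
      qed
      have "y \<otimes> (g \<otimes> h) = (y \<otimes> (g \<otimes> y)) \<otimes> (h \<otimes> y)"
        unfolding prod[symmetric] using gh y by (simp add: m_assoc)
      then have "g \<otimes> h \<otimes> y = y \<otimes> (g \<otimes> h)"
        using gh y by (simp add: yg m_assoc)
      then show ?thesis using g h prod by simp
    qed
  qed
qed

text \<open>Since the group is finite, the hypothesis says that automorphisms preserve every cyclic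
  subgroup. Applied to inner automorphisms it supplies the Dedekind condition, applied to the twist
  a contradiction.\<close>

theorem cyclic_if_all_automorphisms_power:
  assumes fin: "finite (carrier G)"
    and power: "\<And>\<phi> x. \<phi> \<in> auto G \<Longrightarrow> x \<in> carrier G \<Longrightarrow> \<exists>n::nat. \<phi> x = x [^] n"
  shows "cyclic_group G"
proof (cases "\<forall>x\<in>carrier G. \<forall>y\<in>carrier G. x \<otimes> y = y \<otimes> x")
  case True
  then interpret comm_group G
    by (intro group_comm_groupI) auto
  show ?thesis
    using cyclic_if_power_automorphisms[OF fin] power by blast
next
  case False
  interpret finite_dedekind_group G
  proof
    show "\<exists>n::nat. y \<otimes> x \<otimes> inv y = x [^] n" if "x \<in> carrier G" "y \<in> carrier G" for x y
      using power[OF restrict_conj_in_auto[OF fin that(2)] that(1)] that by simp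
  qed (rule fin)
  obtain x y where xy: "x \<in> carrier G" "y \<in> carrier G" "x \<otimes> y \<noteq> y \<otimes> x"
    and inverts: "\<And>g. g \<in> carrier G \<Longrightarrow> g \<otimes> y = y \<otimes> g \<or> g \<otimes> y = inv y \<otimes> g"
    using False exists_inverted_element by metis
  \<comment> \<open>The twist sends \<open>x\<close> to \<open>x \<otimes> y\<close>. Were this a
    power of \<open>x\<close>, it would commute with \<open>x\<close>, and then so would
    \<open>y\<close>.\<close>
  obtain n where n: "x \<otimes> y = x [^] (n::nat)"
    using power[OF twist_in_auto[OF fin xy(2) inverts] xy(1)] xy by auto
  have "x \<otimes> (x \<otimes> y) = (x \<otimes> y) \<otimes> x"
    unfolding n using xy by (metis group_commutes_pow)
  then have False using xy by (simp add: m_assoc)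
  then show ?thesis ..
qed

end

theorem theorem6p3:
  fixes F :: "('f, 'm) ring_scheme" and G :: "('g, 'n) monoid_scheme"
  assumes "field F" and "group G" and "finite (carrier G)" and "\<not> cyclic_group G"
  shows "\<exists>S1 S2. s_ring F G S1 \<and> s_ring F G S2 \<and> S1 \<noteq> S2 \<and> cayley_isomorphic F G S1 S2"
proof -
  interpret finite_group_algebra F G
    using assms by (simp add: finite_group_algebra_def finite_group_algebra_axioms_def)
  obtain \<phi> x where \<phi>: "\<phi> \<in> auto G" and x: "x \<in> carrier G" and moved: "\<And>n::nat. \<phi> x \<noteq> x [^]\<^bsub>G\<^esub> n"
    using G.cyclic_if_all_automorphisms_power[OF assms(3)] assms(4) by metis
  let ?H = "generate G {x}"
  have "?H = {x [^]\<^bsub>G\<^esub> n | n. n \<in> (UNIV :: nat set)}"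
    using G.generate_pow_on_finite_carrier[OF assms(3) x] .
  then have "\<phi> x \<notin> ?H" using moved by auto
  moreover have "x \<in> ?H" by (auto intro: generate.incl)
  ultimately have "\<phi> ` ?H \<noteq> ?H" by blast
  moreover have "subgroup ?H G"
    using x by (intro G.generate_is_subgroup) auto
  ultimately show ?thesis
    using distinct_cayley_isomorphic_s_rings[OF \<phi>] by blast
qed

end
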